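(* Let $(M,g,\Phi)$ be a locally conformal parallel ${\rm Spin}(7)$-structure on an $8$-dimensional Riemannian manifold, with intrinsic torsion $\xi$, Lee form $\theta$ and minimal ${\rm Spin}(7)$-connection $\nabla^{{\rm Spin}(7)}$. Then the intrinsic torsion is parallel, i.e. $\nabla^{{\rm Spin}(7)}\xi=0$, if and only if $\nabla^{{\rm Spin}(7)}\theta=0$.
   Context: A ${\rm Spin}(7)$-structure on an $8$-dimensional Riemannian manifold $(M,g)$ is a global $4$-form $\Phi$ such that around each point there is a local orthonormal frame $e_0,\dots,e_7$ with dual coframe $e^0,\dots,e^7$ in which (writing $e^{ijkl}=e^i\wedge e^j\wedge e^k\wedge e^l$) $$\Phi=e^{0123}-e^{0145}-e^{0167}-e^{0246}+e^{0257}-e^{0347}-e^{0356}+e^{4567}-e^{2367}-e^{2345}-e^{1357}+e^{1346}-e^{1256}-e^{1247}.$$ $M$ is oriented by $e^{01234567}$, $\star$ is the Hodge star, $\star\Phi=\Phi$, and $\delta\Phi=-\star d\star\Phi$ is the codifferential. ${\rm Spin}(7)\subset SO(8)$ is the stabilizer of $\Phi$. Pointwise, $\Lambda^2=\Lambda^2_7\oplus\Lambda^2_{21}$ with $\Lambda^2_7=\{\omega:\star(\Phi\wedge\omega)=3\omega\}$ and $\Lambda^2_{21}=\{\omega:\star(\Phi\wedge\omega)=-\omega\}$. Skew endomorphisms $A$ of $TM$ are identified with $2$-forms via $(Y,Z)\mapsto g(AY,Z)$; with this identification $\mathfrak{so}(8)=\mathfrak{spin}(7)\oplus\mathfrak{spin}(7)^{\perp}$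 corresponds to $\Lambda^2=\Lambda^2_{21}\oplus\Lambda^2_7$. Lee form: $\theta=\frac{1}{7}\star(\delta\Phi\wedge\Phi)$. The structure is locally conformal parallel (type $\mathcal{W}_8$) if $d\Phi=\theta\wedge\Phi$; equivalently, its intrinsic torsion is $\xi_X=\frac14(X^\flat\wedge\theta)_7$, where the subscript $7$ denotes the $\Lambda^2_7$-component. Let $\nabla$ be the Levi-Civita connection. The minimal ${\rm Spin}(7)$-connection $\nabla^{{\rm Spin}(7)}$ is the connection given by the $\mathfrak{spin}(7)$-component of the Levi-Civita connection form; the intrinsic torsion is the $(1,2)$-tensor $\xi=\nabla^{{\rm Spin}(7)}-\nabla$. Equivalently, $\nabla^{{\rm Spin}(7)}=\nabla+\xi$ is the unique metric connection with $\nabla^{{\rm Spin}(7)}\Phi=0$ and $\xi_X\in\Lambda^2_7$ for all $X$. *)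

theory Defs
  imports "HOL-Analysis.Analysis"
begin

section \<open>Smooth manifolds and tensor fields\<close>

text \<open>The order-\<open>k\<close> clause is meant for open \<open>S\<close>, where it says that all iterated
  directional derivatives up to order \<open>k\<close> exist and are continuous.\<close>

fun Ck_on :: "nat \<Rightarrow> 'v::real_normed_vector set \<Rightarrow> ('v \<Rightarrow> 'w::real_normed_vector) \<Rightarrow> bool" where
  "Ck_on 0 S f \<longleftrightarrow> continuous_on S f"
| "Ck_on (Suc k) S f \<longleftrightarrow>
     (\<forall>x\<in>S. f differentiable (at x)) \<and> (\<forall>v. Ck_on k S (\<lambda>x. frechet_derivative f (at x) v))"

definition smooth_on :: "'v::real_normed_vector set \<Rightarrow> ('v \<Rightarrow> 'w::real_normed_vector) \<Rightarrow> bool" where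
  "smooth_on S f \<longleftrightarrow> (\<forall>k. Ck_on k S f)"

type_synonym ('a, 'n) chart = "'a set \<times> ('a \<Rightarrow> real^'n)"

definition chart_image :: "('a, 'n::finite) chart \<Rightarrow> (real^'n) set" where
  "chart_image c = snd c ` fst c"

definition chart_overlap :: "('a, 'n::finite) chart \<Rightarrow> ('a, 'n) chart \<Rightarrow> (real^'n) set" where
  "chart_overlap c c' = snd c ` (fst c \<inter> fst c')"

definition transition :: "('a, 'n::finite) chart \<Rightarrow> ('a, 'n) chart \<Rightarrow> real^'n \<Rightarrow> real^'n" where
  "transition c c' = snd c' \<circ> inv_into (fst c) (snd c)"

text \<open>The atlas need not be maximal: any atlas determines the smooth structure.\<close>

definition smooth_manifold :: "'a topology \<Rightarrow> ('a, 'n::finite) chart set \<Rightarrow> bool" where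
  "smooth_manifold M A \<longleftrightarrow>
     Hausdorff_space M \<and> second_countable M \<and> (\<Union>c\<in>A. fst c) = topspace M \<and>
     (\<forall>c\<in>A. openin M (fst c) \<and> open (chart_image c) \<and>
        homeomorphic_map (subtopology M (fst c)) (top_of_set (chart_image c)) (snd c)) \<and>
     (\<forall>c\<in>A. \<forall>c'\<in>A. smooth_on (chart_overlap c c') (transition c c'))"

text \<open>A covariant \<open>k\<close>-tensor on a vector space is a function on lists of vectors, of which only
  the values at lists of length \<open>k\<close> are relevant.\<close>

definition multilinear_form :: "nat \<Rightarrow> ('v::real_vector list \<Rightarrow> real) \<Rightarrow> bool" where
  "multilinear_form k T \<longleftrightarrow> (\<forall>vs i. length vs = k \<longrightarrow> i < k \<longrightarrow> linear (\<lambda>v. T (vs[i := v])))"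

definition alternating_form :: "nat \<Rightarrow> ('v::real_vector list \<Rightarrow> real) \<Rightarrow> bool" where
  "alternating_form k T \<longleftrightarrow> multilinear_form k T \<and>
     (\<forall>vs. length vs = k \<longrightarrow> \<not> distinct vs \<longrightarrow> T vs = 0)"

text \<open>A covariant tensor field is given by its coordinate expression in every chart of the atlas,
  at the points of the chart image; coordinate expressions in overlapping charts are related by
  pull-back along the change of coordinates.\<close>

type_synonym ('a, 'n) cov_field = "('a, 'n) chart \<Rightarrow> real^'n \<Rightarrow> (real^'n) list \<Rightarrow> real"

definition tensor_field :: "('a, 'n::finite) chart set \<Rightarrow> nat \<Rightarrow> ('a, 'n) cov_field \<Rightarrow> bool" where
  "tensor_field A k T \<longleftrightarrow>
     (\<forall>c\<in>A. (\<forall>x\<in>chart_image c. multilinear_form k (T c x)) \<and>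
            (\<forall>vs. length vs = k \<longrightarrow> smooth_on (chart_image c) (\<lambda>x. T c x vs))) \<and>
     (\<forall>c\<in>A. \<forall>c'\<in>A. \<forall>x\<in>chart_overlap c c'. \<forall>vs. length vs = k \<longrightarrow>
        T c x vs = T c' (transition c c' x) (map (frechet_derivative (transition c c') (at x)) vs))"

definition form_field :: "('a, 'n::finite) chart set \<Rightarrow> nat \<Rightarrow> ('a, 'n) cov_field \<Rightarrow> bool" where
  "form_field A k T \<longleftrightarrow> tensor_field A k T \<and>
     (\<forall>c\<in>A. \<forall>x\<in>chart_image c. alternating_form k (T c x))"

definition riemannian_metric :: "('a, 'n::finite) chart set \<Rightarrow> ('a, 'n) cov_field \<Rightarrow> bool" where
  "riemannian_metric A g \<longleftrightarrow> tensor_field A 2 g \<and>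
     (\<forall>c\<in>A. \<forall>x\<in>chart_image c.
        (\<forall>u v. g c x [u, v] = g c x [v, u]) \<and> (\<forall>v. v \<noteq> 0 \<longrightarrow> g c x [v, v] > 0))"


section \<open>Connections\<close>

text \<open>A connection is given by its Christoffel symbols in every chart: \<open>\<Gamma> c x u v\<close> is the covariant
  derivative at \<open>x\<close>, in direction \<open>u\<close>, of the vector field with constant coordinates \<open>v\<close>.\<close>

type_synonym ('a, 'n) christoffel = "('a, 'n) chart \<Rightarrow> real^'n \<Rightarrow> real^'n \<Rightarrow> real^'n \<Rightarrow> real^'n"

definition connection :: "('a, 'n::finite) chart set \<Rightarrow> ('a, 'n) christoffel \<Rightarrow> bool" where
  "connection A \<Gamma> \<longleftrightarrow>
     (\<forall>c\<in>A. (\<forall>x\<in>chart_image c. bilinear (\<Gamma> c x)) \<and>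
            (\<forall>u v. smooth_on (chart_image c) (\<lambda>x. \<Gamma> c x u v))) \<and>
     (\<forall>c\<in>A. \<forall>c'\<in>A. \<forall>x\<in>chart_overlap c c'. \<forall>u v.
        let \<tau> = transition c c'; d\<tau> = (\<lambda>y. frechet_derivative \<tau> (at y)) in
        d\<tau> x (\<Gamma> c x u v) =
          frechet_derivative (\<lambda>y. d\<tau> y v) (at x) u + \<Gamma> c' (\<tau> x) (d\<tau> x u) (d\<tau> x v))"

text \<open>In the following three definitions \<open>\<Gamma>\<close> and the fields are coordinate expressions in one
  chart; \<open>u\<close> is the direction of differentiation.\<close>

definition cov_deriv_vector ::
  "(real^'n \<Rightarrow> real^'n \<Rightarrow> real^'n \<Rightarrow> real^'n) \<Rightarrow> (real^'n \<Rightarrow> real^'n) \<Rightarrow> real^'n \<Rightarrow> real^'n \<Rightarrow> real^'n" where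
  "cov_deriv_vector \<Gamma> Y x u = frechet_derivative Y (at x) u + \<Gamma> x u (Y x)"

definition cov_deriv_form ::
  "(real^'n \<Rightarrow> real^'n \<Rightarrow> real^'n \<Rightarrow> real^'n) \<Rightarrow> (real^'n \<Rightarrow> (real^'n) list \<Rightarrow> real)
     \<Rightarrow> real^'n \<Rightarrow> real^'n \<Rightarrow> (real^'n) list \<Rightarrow> real" where
  "cov_deriv_form \<Gamma> T x u vs =
     frechet_derivative (\<lambda>y. T y vs) (at x) u - (\<Sum>i<length vs. T x (vs[i := \<Gamma> x u (vs ! i)]))"

definition cov_deriv_12 ::
  "(real^'n \<Rightarrow> real^'n \<Rightarrow> real^'n \<Rightarrow> real^'n) \<Rightarrow> (real^'n \<Rightarrow> real^'n \<Rightarrow> real^'n \<Rightarrow> real^'n)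
     \<Rightarrow> real^'n \<Rightarrow> real^'n \<Rightarrow> real^'n \<Rightarrow> real^'n \<Rightarrow> real^'n" where
  "cov_deriv_12 \<Gamma> T x u v w =
     frechet_derivative (\<lambda>y. T y v w) (at x) u + \<Gamma> x u (T x v w)
       - T x (\<Gamma> x u v) w - T x v (\<Gamma> x u w)"

definition parallel_form ::
  "('a, 'n::finite) chart set \<Rightarrow> ('a, 'n) christoffel \<Rightarrow> nat \<Rightarrow> ('a, 'n) cov_field \<Rightarrow> bool" where
  "parallel_form A \<Gamma> k T \<longleftrightarrow>
     (\<forall>c\<in>A. \<forall>x\<in>chart_image c. \<forall>u vs. length vs = k \<longrightarrow> cov_deriv_form (\<Gamma> c) (T c) x u vs = 0)"

definition parallel_12 ::
  "('a, 'n::finite) chart set \<Rightarrow> ('a, 'n) christoffel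
     \<Rightarrow> (('a, 'n) chart \<Rightarrow> real^'n \<Rightarrow> real^'n \<Rightarrow> real^'n \<Rightarrow> real^'n) \<Rightarrow> bool" where
  "parallel_12 A \<Gamma> T \<longleftrightarrow>
     (\<forall>c\<in>A. \<forall>x\<in>chart_image c. \<forall>u v w. cov_deriv_12 (\<Gamma> c) (T c) x u v w = 0)"

text \<open>Coordinate vector fields commute, so vanishing torsion is symmetry of the Christoffel symbols.\<close>

definition levi_civita ::
  "('a, 'n::finite) chart set \<Rightarrow> ('a, 'n) cov_field \<Rightarrow> ('a, 'n) christoffel \<Rightarrow> bool" where
  "levi_civita A g \<Gamma> \<longleftrightarrow> connection A \<Gamma> \<and>
     (\<forall>c\<in>A. \<forall>x\<in>chart_image c. \<forall>u v. \<Gamma> c x u v = \<Gamma> c x v u) \<and> parallel_form A \<Gamma> 2 g"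


section \<open>Exterior calculus\<close>

text \<open>The wedge product of a \<open>p\<close>-form with another form, by the shuffle formula: \<open>S\<close> is the set of
  positions of the arguments passed to the first factor. Thus \<open>(a \<and> b)(u, v) = a u b v - a v b u\<close>
  for covectors.\<close>

definition wedge :: "nat \<Rightarrow> ('v list \<Rightarrow> real) \<Rightarrow> ('v list \<Rightarrow> real) \<Rightarrow> 'v list \<Rightarrow> real" where
  "wedge p \<alpha> \<beta> vs =
     (\<Sum>S | S \<subseteq> {..<length vs} \<and> card S = p.
        (-1) ^ card {(i, j). i \<in> S \<and> j \<in> {..<length vs} - S \<and> j < i} *
          \<alpha> (nths vs S) * \<beta> (nths vs ({..<length vs} - S)))"

fun wedge_covectors :: "('v \<Rightarrow> real) list \<Rightarrow> 'v list \<Rightarrow> real" where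
  "wedge_covectors [] = (\<lambda>vs. 1)"
| "wedge_covectors (a # as) = wedge 1 (\<lambda>vs. a (hd vs)) (wedge_covectors as)"

definition ext_deriv ::
  "('v::real_normed_vector \<Rightarrow> 'v list \<Rightarrow> real) \<Rightarrow> 'v \<Rightarrow> 'v list \<Rightarrow> real" where
  "ext_deriv \<omega> x vs =
     (\<Sum>i<length vs. (-1) ^ i *
        frechet_derivative (\<lambda>y. \<omega> y (take i vs @ drop (Suc i) vs)) (at x) (vs ! i))"


section \<open>Spin(7)-structures\<close>

text \<open>The index type \<open>8\<close> has the elements \<open>0, \<dots>, 7\<close>.\<close>

definition spin7_form :: "(8 \<Rightarrow> 'v \<Rightarrow> real) \<Rightarrow> 'v list \<Rightarrow> real" where
  "spin7_form \<epsilon> vs = (let E = (\<lambda>is. wedge_covectors (map \<epsilon> is) vs) in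
     E [0,1,2,3] - E [0,1,4,5] - E [0,1,6,7] - E [0,2,4,6] + E [0,2,5,7] - E [0,3,4,7] - E [0,3,5,6]
     + E [4,5,6,7] - E [2,3,6,7] - E [2,3,4,5] - E [1,3,5,7] + E [1,3,4,6] - E [1,2,5,6] - E [1,2,4,7])"

text \<open>In the pointwise definitions below, \<open>G\<close> and \<open>F\<close> are the values at a point of the metric
  and of the 4-form. For an orthonormal basis \<open>e\<close>, the dual basis is \<open>\<lambda>i v. G [e i, v]\<close>.\<close>

definition dual_basis :: "('v list \<Rightarrow> real) \<Rightarrow> (8 \<Rightarrow> 'v) \<Rightarrow> 8 \<Rightarrow> 'v \<Rightarrow> real" where
  "dual_basis G e = (\<lambda>i v. G [e i, v])"

definition adapted_basis :: "('v list \<Rightarrow> real) \<Rightarrow> ('v list \<Rightarrow> real) \<Rightarrow> (8 \<Rightarrow> 'v) \<Rightarrow> bool" where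
  "adapted_basis G F e \<longleftrightarrow>
     (\<forall>i j. G [e i, e j] = (if i = j then 1 else 0)) \<and>
     (\<forall>vs. length vs = 4 \<longrightarrow> F vs = spin7_form (dual_basis G e) vs)"

text \<open>The Hodge star on \<open>p\<close>-forms determined by an orthonormal basis \<open>e\<close> and the orientation
  \<open>vol = e\<^sup>0\<^sup>1\<^sup>2\<^sup>3\<^sup>4\<^sup>5\<^sup>6\<^sup>7\<close>; it maps \<open>e\<^sup>I\<close> to \<open>vol (e\<^sub>I, \<dots>)\<close>, so that \<open>\<alpha> \<and> \<star>\<beta> = \<langle>\<alpha>, \<beta>\<rangle> vol\<close>.\<close>

definition hodge_basis ::
  "('v list \<Rightarrow> real) \<Rightarrow> (8 \<Rightarrow> 'v) \<Rightarrow> nat \<Rightarrow> ('v list \<Rightarrow> real) \<Rightarrow> 'v list \<Rightarrow> real" where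
  "hodge_basis G e p \<omega> vs =
     (\<Sum>I | card I = p.
        \<omega> (map e (sorted_list_of_set I)) *
        wedge_covectors (map (dual_basis G e) [0,1,2,3,4,5,6,7]) (map e (sorted_list_of_set I) @ vs))"

text \<open>The choice of the adapted basis is immaterial: since Spin(7) is contained in SO(8), all
  adapted bases induce the same orientation.\<close>

definition hodge ::
  "('v list \<Rightarrow> real) \<Rightarrow> ('v list \<Rightarrow> real) \<Rightarrow> nat \<Rightarrow> ('v list \<Rightarrow> real) \<Rightarrow> 'v list \<Rightarrow> real" where
  "hodge G F = hodge_basis G (SOME e. adapted_basis G F e)"

definition Lambda2_7 ::
  "('v::real_vector list \<Rightarrow> real) \<Rightarrow> ('v list \<Rightarrow> real) \<Rightarrow> ('v list \<Rightarrow> real) set" where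
  "Lambda2_7 G F = {\<omega>. alternating_form 2 \<omega> \<and>
     (\<forall>vs. length vs = 2 \<longrightarrow> hodge G F 6 (wedge 4 F \<omega>) vs = 3 * \<omega> vs)}"

definition Lambda2_21 ::
  "('v::real_vector list \<Rightarrow> real) \<Rightarrow> ('v list \<Rightarrow> real) \<Rightarrow> ('v list \<Rightarrow> real) set" where
  "Lambda2_21 G F = {\<omega>. alternating_form 2 \<omega> \<and>
     (\<forall>vs. length vs = 2 \<longrightarrow> hodge G F 6 (wedge 4 F \<omega>) vs = - \<omega> vs)}"

definition form_of_endo :: "('v list \<Rightarrow> real) \<Rightarrow> ('v \<Rightarrow> 'v) \<Rightarrow> 'v list \<Rightarrow> real" where
  "form_of_endo G B vs = G [B (vs ! 0), vs ! 1]"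

text \<open>A smooth local adapted frame on an open subset \<open>W\<close> of a chart image.\<close>

definition adapted_frame_on ::
  "(real^8) set \<Rightarrow> (real^8 \<Rightarrow> (real^8) list \<Rightarrow> real) \<Rightarrow> (real^8 \<Rightarrow> (real^8) list \<Rightarrow> real)
     \<Rightarrow> (real^8 \<Rightarrow> 8 \<Rightarrow> real^8) \<Rightarrow> bool" where
  "adapted_frame_on W G F e \<longleftrightarrow> open W \<and> (\<forall>i. smooth_on W (\<lambda>x. e x i)) \<and>
     (\<forall>x\<in>W. adapted_basis (G x) (F x) (e x))"

definition spin7_structure ::
  "('a, 8) chart set \<Rightarrow> ('a, 8) cov_field \<Rightarrow> ('a, 8) cov_field \<Rightarrow> bool" where
  "spin7_structure A g \<Phi> \<longleftrightarrow> form_field A 4 \<Phi> \<and>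
     (\<forall>c\<in>A. \<forall>x\<in>chart_image c. \<exists>W e. x \<in> W \<and> W \<subseteq> chart_image c \<and> adapted_frame_on W (g c) (\<Phi> c) e)"

definition hodge_field ::
  "('a, 8) cov_field \<Rightarrow> ('a, 8) cov_field \<Rightarrow> nat \<Rightarrow> ('a, 8) cov_field \<Rightarrow> ('a, 8) cov_field" where
  "hodge_field g \<Phi> p \<omega> = (\<lambda>c x. hodge (g c x) (\<Phi> c x) p (\<omega> c x))"

definition wedge_field ::
  "nat \<Rightarrow> ('a, 'n::finite) cov_field \<Rightarrow> ('a, 'n) cov_field \<Rightarrow> ('a, 'n) cov_field" where
  "wedge_field p \<alpha> \<beta> = (\<lambda>c x. wedge p (\<alpha> c x) (\<beta> c x))"

definition ext_deriv_field :: "('a, 'n::finite) cov_field \<Rightarrow> ('a, 'n) cov_field" where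
  "ext_deriv_field \<omega> = (\<lambda>c. ext_deriv (\<omega> c))"

text \<open>\<open>\<delta>\<Phi> = - \<star> d \<star> \<Phi>\<close> and \<open>\<theta> = 1/7 \<star>(\<delta>\<Phi> \<and> \<Phi>)\<close>; the form \<open>d \<star> \<Phi>\<close> has degree 5, \<open>\<delta>\<Phi>\<close> has
  degree 3 and \<open>\<delta>\<Phi> \<and> \<Phi>\<close> has degree 7.\<close>

definition codiff_Phi :: "('a, 8) cov_field \<Rightarrow> ('a, 8) cov_field \<Rightarrow> ('a, 8) cov_field" where
  "codiff_Phi g \<Phi> = (\<lambda>c x vs. - hodge_field g \<Phi> 5 (ext_deriv_field (hodge_field g \<Phi> 4 \<Phi>)) c x vs)"

definition lee_form :: "('a, 8) cov_field \<Rightarrow> ('a, 8) cov_field \<Rightarrow> ('a, 8) cov_field" where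
  "lee_form g \<Phi> = (\<lambda>c x vs. 1/7 * hodge_field g \<Phi> 7 (wedge_field 3 (codiff_Phi g \<Phi>) \<Phi>) c x vs)"

definition locally_conformal_parallel ::
  "('a, 8) chart set \<Rightarrow> ('a, 8) cov_field \<Rightarrow> ('a, 8) cov_field \<Rightarrow> bool" where
  "locally_conformal_parallel A g \<Phi> \<longleftrightarrow>
     (\<forall>c\<in>A. \<forall>x\<in>chart_image c. \<forall>vs. length vs = 5 \<longrightarrow>
        ext_deriv_field \<Phi> c x vs = wedge_field 1 (lee_form g \<Phi>) \<Phi> c x vs)"

text \<open>In an adapted local frame \<open>e\<close>, the value at \<open>u\<close> of the connection form of \<open>nab\<close> is the skew
  endomorphism taking \<open>e\<^sub>j\<close> to the derivative of \<open>e\<^sub>j\<close> in direction \<open>u\<close>. It is decomposed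
  as \<open>B + C\<close> with \<open>B\<close> in spin(7), i.e. in \<open>\<Lambda>\<^sup>2\<^sub>2\<^sub>1\<close>, and \<open>C\<close> in its complement \<open>\<Lambda>\<^sup>2\<^sub>7\<close>; the connection
  form of the minimal connection \<open>D\<close> is \<open>B\<close>.\<close>

definition minimal_spin7_connection ::
  "('a, 8) chart set \<Rightarrow> ('a, 8) cov_field \<Rightarrow> ('a, 8) cov_field
     \<Rightarrow> ('a, 8) christoffel \<Rightarrow> ('a, 8) christoffel \<Rightarrow> bool" where
  "minimal_spin7_connection A g \<Phi> nab D \<longleftrightarrow> connection A D \<and>
     (\<forall>c\<in>A. \<forall>W e. W \<subseteq> chart_image c \<longrightarrow> adapted_frame_on W (g c) (\<Phi> c) e \<longrightarrow>
        (\<forall>x\<in>W. \<forall>u. \<exists>B C.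
           form_of_endo (g c x) B \<in> Lambda2_21 (g c x) (\<Phi> c x) \<and>
           form_of_endo (g c x) C \<in> Lambda2_7 (g c x) (\<Phi> c x) \<and>
           (\<forall>j. cov_deriv_vector (nab c) (\<lambda>y. e y j) x u = B (e x j) + C (e x j)) \<and>
           (\<forall>j. cov_deriv_vector (D c) (\<lambda>y. e y j) x u = B (e x j))))"

definition intrinsic_torsion ::
  "('a, 8) christoffel \<Rightarrow> ('a, 8) christoffel \<Rightarrow> ('a, 8) chart \<Rightarrow> real^8 \<Rightarrow> real^8 \<Rightarrow> real^8 \<Rightarrow> real^8" where
  "intrinsic_torsion nab D = (\<lambda>c x u v. D c x u v - nab c x u v)"

end

theory Submission
  imports Defs
begin

text \<open>Write \<open>C = - \<xi>\<close>. Since \<open>\<Phi>\<close> is parallel for the minimal connection \<open>D\<close>, the form \<open>d\<Phi>\<close> depends only on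
  the torsion of \<open>D\<close>, that is, on the part of \<open>C\<close> skew in its two arguments. At a point, \<open>C\<close> has values in \<open>\<Lambda>\<^sup>2\<^sub>7\<close>, and
  \<open>d\<Phi> = \<theta> \<and> \<Phi>\<close> is a linear system of 56 equations for its 56 components. The system is uniquely solvable:
  with \<open>t\<close> the vector dual to \<open>\<theta>\<close>,
  \<open>16 g(C(u, v), w) = g(t, v) g(u, w) - g(t, w) g(u, v) + \<Phi>(t, u, v, w)\<close>.
  As \<open>g\<close> and \<open>\<Phi>\<close> are \<open>D\<close>-parallel, differentiating gives the same formula with \<open>D\<^sub>u C\<close> in place of \<open>C\<close> and
  \<open>D\<^sub>u t\<close> in place of \<open>t\<close>. Hence \<open>D\<^sub>u C\<close> vanishes if \<open>D\<^sub>u t\<close> does; the converse follows by taking the trace,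
  because \<open>\<Sum>\<^sub>i C(e\<^sub>i, e\<^sub>i) = - (7/16) t\<close>.\<close>

text \<open>The constant 16 is 4 times 4. The intrinsic torsion in direction u is one quarter of the
  \<open>\<Lambda>\<^sup>2\<^sub>7\<close>-part of \<open>u \<and> \<theta>\<close> (u read as a
  covector), and this part of a 2-form \<omega> is
  \<open>(\<omega> + \<star>(\<Phi> \<and> \<omega>)) / 4\<close>, because the star operator has the
  eigenvalues 3 and -1. The operator contracts \<omega> with \<Phi>, which produces the term
  \<open>\<Phi>(t, u, v, w)\<close>. The equations can be solved by hand-sized systems because of a
  grading. Read the indices 0, ..., 7 in binary as elements of (Z/2)^3, with addition as bitwise
  exclusive or. The 14 quadruples of \<Phi> are exactly the affine planes, that is, the four-element
  sets with sum 0, so \<Phi> applied to three distinct basis vectors with indices i, j, k leaves, up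
  to sign, the dual covector with index i + j + k. Hence index sums are preserved: the star operator
  on 2-forms splits into seven 4 by 4 blocks, and the equations for C split according to the sum of
  their five indices.\<close>

section \<open>Wedge products on lists\<close>

lemma finite_card_subsets: "finite {S. S \<subseteq> {..<n::nat} \<and> card S = p}"
  by (rule finite_subset[of _ "Pow {..<n}"]) auto

lemma wedge_Nil: "wedge p \<alpha> \<beta> [] = (if p = 0 then \<alpha> [] * \<beta> [] else 0)"
proof -
  have "{S::nat set. S = {} \<and> card S = p} = (if p = 0 then {{}} else {})" by auto
  then show ?thesis by (simp add: wedge_def)
qed

lemma wedge_0: "wedge 0 \<alpha> \<beta> vs = \<alpha> [] * \<beta> vs"
proof -
  have "{S. S \<subseteq> {..<length vs} \<and> card S = 0} = {{}}"
    by (auto dest: finite_subset)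
  moreover have "nths vs {..<length vs} = vs"
    by (simp add: nths_all)
  ultimately show ?thesis by (simp add: wedge_def)
qed

lemma subsets_lessThan_Suc:
  "{S. S \<subseteq> {..<Suc n} \<and> card S = Suc p} =
     (\<lambda>S. insert 0 (Suc ` S)) ` {S. S \<subseteq> {..<n} \<and> card S = p} \<union> image Suc ` {S. S \<subseteq> {..<n} \<and> card S = Suc p}"
proof (intro set_eqI iffI)
  fix S assume "S \<in> {S. S \<subseteq> {..<Suc n} \<and> card S = Suc p}"
  then have S: "S \<subseteq> {..<Suc n}" "card S = Suc p" by auto
  then have fin: "finite S" by (auto intro: finite_subset)
  let ?T = "{j. Suc j \<in> S}"
  have T: "?T \<subseteq> {..<n}" using S by auto
  have im: "Suc ` ?T = S - {0}" by (auto simp: image_iff) (metis not0_implies_Suc)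
  then have cT: "card ?T = card (S - {0})" by (metis card_image inj_Suc)
  show "S \<in> (\<lambda>S. insert 0 (Suc ` S)) ` {S. S \<subseteq> {..<n} \<and> card S = p} \<union> image Suc ` {S. S \<subseteq> {..<n} \<and> card S = Suc p}"
  proof (cases "0 \<in> S")
    case True
    then have "S = insert 0 (Suc ` ?T)" "card ?T = p" using im cT S fin by auto
    then show ?thesis using T by blast
  next
    case False
    then have "S = Suc ` ?T" "card ?T = Suc p" using im cT S fin by auto
    then show ?thesis using T by blast
  qed
next
  fix S assume "S \<in> (\<lambda>S. insert 0 (Suc ` S)) ` {S. S \<subseteq> {..<n} \<and> card S = p} \<union> image Suc ` {S. S \<subseteq> {..<n} \<and> card S = Suc p}"
  then show "S \<in> {S. S \<subseteq> {..<Suc n} \<and> card S = Suc p}"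
    by (auto simp: card_image finite_subset[of _ "{..<n}"] card_insert_if)
qed

text \<open>The exponent of the shuffle sign: the number of adjacent transpositions that bring the
  positions in \<open>S\<close> to the front.\<close>

definition inversions :: "nat \<Rightarrow> nat set \<Rightarrow> nat" where
  "inversions n S = card {(i, j). i \<in> S \<and> j \<in> {..<n} - S \<and> j < i}"

lemma mem_map_prod_Suc:
  "(i, j) \<in> map_prod Suc Suc ` X \<longleftrightarrow> (\<exists>i' j'. i = Suc i' \<and> j = Suc j' \<and> (i', j') \<in> X)"
  by force

lemma inversions_insert: "inversions (Suc n) (insert 0 (Suc ` S)) = inversions n S"
proof -
  have "{(i, j). i \<in> insert 0 (Suc ` S) \<and> j \<in> {..<Suc n} - insert 0 (Suc ` S) \<and> j < i} =
    map_prod Suc Suc ` {(i, j). i \<in> S \<and> j \<in> {..<n} - S \<and> j < i}"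
    (is "?L = ?R")
  proof (rule set_eqI)
    fix x show "x \<in> ?L \<longleftrightarrow> x \<in> ?R"
      by (cases x; cases "fst x"; cases "snd x") (auto simp: mem_map_prod_Suc inj_image_mem_iff)
  qed
  then show ?thesis unfolding inversions_def
    by (simp only:) (rule card_image, auto intro!: inj_onI)
qed

text \<open>A new first argument that goes to the second factor is passed by every argument of the
  first factor, which costs one transposition for each element of \<open>S\<close>.\<close>

lemma inversions_shift:
  assumes "S \<subseteq> {..<n}"
  shows "inversions (Suc n) (Suc ` S) = card S + inversions n S"
proof -
  have fin: "finite S" using assms by (rule finite_subset) simp
  have eq: "{(i, j). i \<in> Suc ` S \<and> j \<in> {..<Suc n} - Suc ` S \<and> j < i} =
    (\<lambda>i. (Suc i, 0)) ` S \<union> map_prod Suc Suc ` {(i, j). i \<in> S \<and> j \<in> {..<n} - S \<and> j < i}" (is "?L = ?A \<union> ?B")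
  proof (rule set_eqI)
    fix x show "x \<in> ?L \<longleftrightarrow> x \<in> ?A \<union> ?B"
      by (cases x; cases "fst x"; cases "snd x") (auto simp: mem_map_prod_Suc inj_image_mem_iff)
  qed
  have "finite {(i, j). i \<in> S \<and> j \<in> {..<n} - S \<and> j < i}"
    by (rule finite_subset[of _ "S \<times> {..<n}"]) (use fin in auto)
  then have "card (?A \<union> ?B) = card ?A + card ?B"
    by (intro card_Un_disjoint) (use fin in auto)
  moreover have "card ?A = card S" by (rule card_image) (auto intro!: inj_onI)
  moreover have "card ?B = inversions n S" unfolding inversions_def
    by (rule card_image) (auto intro!: inj_onI)
  ultimately show ?thesis unfolding inversions_def eq by simp
qed

lemma wedge_inversions:
  "wedge p \<alpha> \<beta> vs = (\<Sum>S | S \<subseteq> {..<length vs} \<and> card S = p.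
     (-1) ^ inversions (length vs) S * \<alpha> (nths vs S) * \<beta> (nths vs ({..<length vs} - S)))"
  by (simp add: wedge_def inversions_def)

text \<open>Contraction with a vector is an antiderivation: the position sets are split according to
  whether the first position is given to the first factor. Together with \<open>wedge_0\<close> and
  \<open>wedge_Nil\<close> this evaluates explicit wedge products by rewriting.\<close>

lemma wedge_Cons:
  "wedge (Suc p) \<alpha> \<beta> (v # vs) =
     wedge p (\<lambda>us. \<alpha> (v # us)) \<beta> vs + (-1) ^ Suc p * wedge (Suc p) \<alpha> (\<lambda>us. \<beta> (v # us)) vs"
proof -
  let ?n = "length vs"
  let ?f = "\<lambda>S. (-1) ^ inversions (Suc ?n) S * \<alpha> (nths (v # vs) S) * \<beta> (nths (v # vs) ({..<Suc ?n} - S))"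
  let ?P = "{S. S \<subseteq> {..<?n} \<and> card S = p}" and ?Q = "{S. S \<subseteq> {..<?n} \<and> card S = Suc p}"
  have inj1: "inj_on (\<lambda>S. insert 0 (Suc ` S)) ?P"
    by (auto intro!: inj_onI simp: insert_ident inj_image_eq_iff)
  have inj2: "inj_on (image Suc) ?Q"
    by (auto intro!: inj_onI simp: inj_image_eq_iff)
  have "wedge (Suc p) \<alpha> \<beta> (v # vs) = sum ?f ((\<lambda>S. insert 0 (Suc ` S)) ` ?P \<union> image Suc ` ?Q)"
    unfolding wedge_inversions subsets_lessThan_Suc[symmetric] by simp
  also have "\<dots> = sum ?f ((\<lambda>S. insert 0 (Suc ` S)) ` ?P) + sum ?f (image Suc ` ?Q)"
    by (rule sum.union_disjoint) (auto simp: finite_card_subsets)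
  also have "sum ?f ((\<lambda>S. insert 0 (Suc ` S)) ` ?P) = wedge p (\<lambda>us. \<alpha> (v # us)) \<beta> vs"
    unfolding wedge_inversions sum.reindex[OF inj1] o_def
  proof (rule sum.cong[OF refl])
    fix S assume "S \<in> ?P"
    have "nths vs {j. Suc j < Suc ?n \<and> j \<notin> S} = nths vs ({..<?n} - S)"
      by (rule arg_cong[of _ _ "nths vs"]) auto
    then show "?f (insert 0 (Suc ` S)) = (- 1) ^ inversions ?n S * \<alpha> (v # nths vs S) * \<beta> (nths vs ({..<?n} - S))"
      by (simp add: inversions_insert nths_Cons inj_image_mem_iff)
  qed
  also have "sum ?f (image Suc ` ?Q) = (-1) ^ Suc p * wedge (Suc p) \<alpha> (\<lambda>us. \<beta> (v # us)) vs"
    unfolding wedge_inversions sum.reindex[OF inj2] o_def sum_distrib_left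
  proof (rule sum.cong[OF refl])
    fix S assume "S \<in> ?Q"
    moreover have "nths vs {j. Suc j < Suc ?n \<and> j \<notin> S} = nths vs ({..<?n} - S)"
      by (rule arg_cong[of _ _ "nths vs"]) auto
    ultimately show "?f (Suc ` S) = (- 1) ^ Suc p *
        ((- 1) ^ inversions ?n S * \<alpha> (nths vs S) * \<beta> (v # nths vs ({..<?n} - S)))"
      by (simp add: inversions_shift nths_Cons inj_image_mem_iff power_add)
  qed
  finally show ?thesis .
qed

text \<open>The sublists of length \<open>p\<close>, in list order: a computable stand-in for the
  index sets of cardinality \<open>p\<close> over which the Hodge star sums.\<close>

fun combinations :: "nat \<Rightarrow> 'b list \<Rightarrow> 'b list list" where
  "combinations 0 xs = [[]]"
| "combinations (Suc p) [] = []"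
| "combinations (Suc p) (x # xs) = map (Cons x) (combinations p xs) @ combinations (Suc p) xs"

lemma sum_combinations:
  assumes "sorted_wrt (<) (xs :: 'b::linorder list)"
  shows "(\<Sum>I | I \<subseteq> set xs \<and> card I = p. f (sorted_list_of_set I)) = (\<Sum>l\<leftarrow>combinations p xs. f l :: real)"
  using assms
proof (induction p xs arbitrary: f rule: combinations.induct)
  case (1 xs)
  have "{I. I \<subseteq> set xs \<and> card I = 0} = {{}}" by (auto dest: finite_subset)
  then show ?case by simp
next
  case (2 p)
  have "{I. I \<subseteq> set ([] :: 'b list) \<and> card I = Suc p} = {}" by auto
  then have "sum (\<lambda>I. f (sorted_list_of_set I)) {I. I \<subseteq> set [] \<and> card I = Suc p} = 0"
    by (metis sum.empty)
  then show ?case by simp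
next
  case (3 p x xs)
  let ?P = "{I. I \<subseteq> set xs \<and> card I = p}" and ?Q = "{I. I \<subseteq> set xs \<and> card I = Suc p}"
  have x: "\<And>y. y \<in> set xs \<Longrightarrow> x < y" using 3 by auto
  have fin: "\<And>I. I \<subseteq> set xs \<Longrightarrow> finite I" by (auto intro: finite_subset)
  have xnot: "\<And>I. I \<subseteq> set xs \<Longrightarrow> x \<notin> I" using x by blast
  have "{I. I \<subseteq> set (x # xs) \<and> card I = Suc p} = insert x ` ?P \<union> ?Q" (is "?L = ?R")
  proof (intro set_eqI iffI)
    fix I assume I: "I \<in> ?L"
    show "I \<in> ?R"
    proof (cases "x \<in> I")
      case True
      then have "I = insert x (I - {x})" by auto
      moreover have "I - {x} \<in> ?P" using I True fin by (auto simp: card_Diff_singleton)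
      ultimately show ?thesis by blast
    qed (use I in auto)
  next
    fix I assume "I \<in> ?R"
    then show "I \<in> ?L" using xnot fin by (auto simp: card_insert_if)
  qed
  moreover have "sum (\<lambda>I. f (sorted_list_of_set I)) (insert x ` ?P \<union> ?Q) =
     sum (\<lambda>I. f (sorted_list_of_set I)) (insert x ` ?P) + sum (\<lambda>I. f (sorted_list_of_set I)) ?Q"
    by (rule sum.union_disjoint)
       (use x in \<open>auto intro: finite_subset[of _ "Pow (set xs)"]\<close>)
  moreover have "sum (\<lambda>I. f (sorted_list_of_set I)) (insert x ` ?P) =
     sum (\<lambda>I. f (x # sorted_list_of_set I)) ?P"
  proof (subst sum.reindex)
    show "inj_on (insert x) ?P"
      by (rule inj_onI) (metis (no_types, lifting) insert_ident mem_Collect_eq xnot)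
    show "sum ((\<lambda>I. f (sorted_list_of_set I)) \<circ> insert x) ?P = sum (\<lambda>I. f (x # sorted_list_of_set I)) ?P"
    proof (rule sum.cong[OF refl])
      fix I assume "I \<in> ?P"
      then have I: "I \<subseteq> set xs" by simp
      then have "x \<notin> I" using x by blast
      then have "sorted_list_of_set (insert x I) = insort x (sorted_list_of_set I)"
        using fin[OF I] by simp
      also have "\<dots> = x # sorted_list_of_set I"
        using x I fin[OF I] by (intro insort_is_Cons) (auto simp: less_imp_le)
      finally show "((\<lambda>I. f (sorted_list_of_set I)) \<circ> insert x) I = f (x # sorted_list_of_set I)" by simp
    qed
  qed
  ultimately show ?case using 3 by (simp add: o_def)
qed

text \<open>The second factor is evaluated only at lists of \<open>length vs - p\<close> arguments.
  The induction for \<open>coframe_wedge_basis_Cons\<close> needs this, as its induction hypothesis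
  concerns lists of one fixed length.\<close>

lemma wedge_cong:
  assumes "\<And>us. length us = length vs - p \<Longrightarrow> \<beta> us = \<beta>' us"
  shows "wedge p \<alpha> \<beta> vs = wedge p \<alpha> \<beta>' vs"
  unfolding wedge_def
proof (rule sum.cong[OF refl])
  fix S assume S: "S \<in> {S. S \<subseteq> {..<length vs} \<and> card S = p}"
  then have "{i. i < length vs \<and> i \<in> {..<length vs} - S} = {..<length vs} - S" by auto
  then have "length (nths vs ({..<length vs} - S)) = length vs - p"
    using S card_Diff_subset[of S "{..<length vs}"] finite_subset[of S "{..<length vs}"]
    by (simp add: length_nths)
  then show "(- 1) ^ card {(i, j). i \<in> S \<and> j \<in> {..<length vs} - S \<and> j < i} * \<alpha> (nths vs S) * \<beta> (nths vs ({..<length vs} - S)) =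
    (- 1) ^ card {(i, j). i \<in> S \<and> j \<in> {..<length vs} - S \<and> j < i} * \<alpha> (nths vs S) * \<beta>' (nths vs ({..<length vs} - S))"
    using assms by simp
qed

lemma wedge_scale_right: "wedge p \<alpha> (\<lambda>us. c * \<beta> us) vs = c * wedge p \<alpha> \<beta> vs"
  by (simp add: wedge_def sum_distrib_left mult_ac)

lemma wedge_1:
  "wedge 1 (\<lambda>us. a (hd us)) \<beta> vs =
     (\<Sum>s<length vs. (-1) ^ s * a (vs ! s) * \<beta> (take s vs @ drop (Suc s) vs))"
proof (induction vs arbitrary: \<beta>)
  case Nil
  then show ?case by (simp add: wedge_Nil)
next
  case (Cons v vs)
  have "wedge 1 (\<lambda>us. a (hd us)) \<beta> (v # vs) =
      a v * \<beta> vs - wedge 1 (\<lambda>us. a (hd us)) (\<lambda>us. \<beta> (v # us)) vs"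
    by (simp add: wedge_Cons wedge_0)
  also have "\<dots> = (\<Sum>s<length (v # vs).
      (-1) ^ s * a ((v # vs) ! s) * \<beta> (take s (v # vs) @ drop (Suc s) (v # vs)))"
    unfolding Cons by (simp add: sum.lessThan_Suc_shift sum_negf del: sum.lessThan_Suc)
  finally show ?case .
qed

lemma wedge_covectors_Cons_Cons:
  "wedge_covectors (a # as) (v # vs) =
     a v * wedge_covectors as vs - wedge 1 (\<lambda>vs. a (hd vs)) (\<lambda>us. wedge_covectors as (v # us)) vs"
  by (simp add: wedge_Cons wedge_0)

text \<open>In the Laplace expansion \<open>wedge_1\<close> the last argument is either consumed by
  the first covector or stays last in the remaining product. The last slot is where the star of a
  7-form places its argument in the volume form.\<close>

lemma linear_wedge_covectors_last:
  assumes "length as = Suc (length us)" and "\<And>a. a \<in> set as \<Longrightarrow> linear a"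
  shows "linear (\<lambda>v. wedge_covectors as (us @ [v]))"
  using assms
proof (induction as arbitrary: us)
  case (Cons a as)
  let ?n = "length us"
  let ?f = "\<lambda>s v. (-1) ^ s * a (us ! s) * wedge_covectors as ((take s us @ drop (Suc s) us) @ [v])"
  have "wedge_covectors (a # as) (us @ [v]) =
      (\<Sum>s<?n. ?f s v) + (-1) ^ ?n * wedge_covectors as us * a v" for v
    by (simp add: wedge_1[unfolded One_nat_def] nth_append)
  moreover have "linear (\<lambda>v. \<Sum>s<?n. ?f s v)"
  proof (rule linear_compose_sum, rule ballI)
    fix s assume "s \<in> {..<?n}"
    then have "linear (\<lambda>v. wedge_covectors as ((take s us @ drop (Suc s) us) @ [v]))"
      using Cons.prems by (intro Cons.IH) auto
    then show "linear (?f s)"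
      unfolding linear_iff by (simp add: algebra_simps)
  qed
  moreover have "linear (\<lambda>v. (-1) ^ ?n * wedge_covectors as us * a v)"
    using Cons.prems linear_compose_scale_right[of a "(-1) ^ ?n * wedge_covectors as us"] by simp
  ultimately show ?case using linear_compose_add by (simp del: wedge_covectors.simps) 
qed simp

text \<open>The coefficient that appears when a coframe monomial is contracted with the basis vector
  of index \<open>j\<close>: (-1) to the power of the position of \<open>j\<close>, and 0 if
  \<open>j\<close> does not occur.\<close>

fun index_sign :: "'i \<Rightarrow> 'i list \<Rightarrow> real" where
  "index_sign j [] = 0"
| "index_sign j (i # is) = (if i = j then 1 else - index_sign j is)"

lemma index_sign_notin: "j \<notin> set is \<Longrightarrow> index_sign j is = 0"
  by (induction "is") auto

text \<open>Keeps the index list visible to the simplifier. Otherwise \<open>map\<close> and the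
  recursion of \<open>wedge_covectors\<close> would be unfolded, and the rule for contraction with a
  basis vector would no longer match.\<close>

definition coframe_wedge :: "('i \<Rightarrow> 'v \<Rightarrow> real) \<Rightarrow> 'i list \<Rightarrow> 'v list \<Rightarrow> real" where
  "coframe_wedge \<epsilon> is = wedge_covectors (map \<epsilon> is)"

lemma coframe_wedge_basis_Cons:
  assumes "\<And>i j. \<epsilon> i (e j) = (if i = j then 1 else 0)"
    and "length is = Suc (length vs)" and "distinct is"
  shows "coframe_wedge \<epsilon> is (e j # vs) = index_sign j is * coframe_wedge \<epsilon> (remove1 j is) vs"
  using assms(2,3)
proof (induction "is" arbitrary: vs)
  case (Cons i "is")
  have *: "wedge 1 (\<lambda>vs. \<epsilon> i (hd vs)) (\<lambda>us. coframe_wedge \<epsilon> is (e j # us)) vs =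
    index_sign j is * wedge 1 (\<lambda>vs. \<epsilon> i (hd vs)) (coframe_wedge \<epsilon> (remove1 j is)) vs"
  proof (cases "vs = []")
    case False
    then show ?thesis
      unfolding wedge_scale_right[symmetric]
      by (intro wedge_cong Cons.IH) (use Cons.prems in auto)
  qed (simp add: wedge_Nil)
  show ?case
  proof (cases "i = j")
    case True
    then show ?thesis using * Cons.prems assms(1)
      by (simp add: coframe_wedge_def wedge_covectors_Cons_Cons index_sign_notin del: wedge_covectors.simps)
  next
    case False
    then show ?thesis using * assms(1)
      by (simp add: coframe_wedge_def wedge_covectors_Cons_Cons del: wedge_covectors.simps(2)) simp
  qed
qed simp

lemma coframe_wedge_singleton: "coframe_wedge \<epsilon> [i] [v] = \<epsilon> i v"
  by (simp add: coframe_wedge_def wedge_Cons wedge_0 wedge_Nil)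

text \<open>Naturality under pull-back. Applied to the map sending an index to a frame vector, it
  shows that the coefficients of the 4-form in an adapted frame do not depend on the point.\<close>

lemma wedge_covectors_map:
  "wedge_covectors as (map f vs) = wedge_covectors (map (\<lambda>a. a \<circ> f) as) vs"
proof (induction as arbitrary: vs)
  case (Cons a as)
  have "wedge_covectors (a # as) (map f vs) =
      (\<Sum>s<length vs. (-1) ^ s * a (map f vs ! s) * wedge_covectors as (map f (take s vs @ drop (Suc s) vs)))"
    using wedge_1[of a "wedge_covectors as" "map f vs"] by (simp add: take_map drop_map)
  also have "\<dots> = (\<Sum>s<length vs. (-1) ^ s * (a \<circ> f) (vs ! s) *
      wedge_covectors (map (\<lambda>a. a \<circ> f) as) (take s vs @ drop (Suc s) vs))"
    by (rule sum.cong[OF refl]) (simp only: Cons nth_map lessThan_iff o_def)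
  also have "\<dots> = wedge_covectors (map (\<lambda>a. a \<circ> f) (a # as)) vs"
    using wedge_1[of "a \<circ> f" "wedge_covectors (map (\<lambda>a. a \<circ> f) as)" vs] by simp
  finally show ?case .
qed simp

lemma spin7_form_map: "spin7_form \<epsilon> (map f vs) = spin7_form (\<lambda>i. \<epsilon> i \<circ> f) vs"
  unfolding spin7_form_def wedge_covectors_map by (simp del: wedge_covectors.simps)

section \<open>The index type 8\<close>

lemma UNIV_8: "(UNIV :: 8 set) = {0,1,2,3,4,5,6,7}"
proof -
  have "card ({0,1,2,3,4,5,6,7} :: 8 set) = CARD(8)" by simp
  then show ?thesis using card_subset_eq[OF finite subset_UNIV] by metis
qed

lemma sorted_indices_8: "sorted_wrt (<) [0,1,2,3,4,5,6,7::8]"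
  by (simp add: less_bit0_def bit0.Rep_numeral bit0.Rep_0 bit0.Rep_1)

lemmas less_8_evaluate = less_bit0_def bit0.Rep_numeral bit0.Rep_0 bit0.Rep_1

lemma all_8: "(\<forall>i::8. P i) \<longleftrightarrow> P 0 \<and> P 1 \<and> P 2 \<and> P 3 \<and> P 4 \<and> P 5 \<and> P 6 \<and> P 7"
  using UNIV_8 by (metis (no_types, lifting) UNIV_I empty_iff insert_iff)

lemma sorted_triples:
  fixes P :: "'b::linorder \<Rightarrow> 'b \<Rightarrow> 'b \<Rightarrow> bool"
  assumes "\<And>i j k. P i j k \<Longrightarrow> P j i k" "\<And>i j k. P i j k \<Longrightarrow> P i k j"
    and "\<And>i k. P i i k" "\<And>i j k. i < j \<Longrightarrow> j < k \<Longrightarrow> P i j k"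
  shows "P i j k"
  by (metis assms linorder_less_linear)

text \<open>Reduces an antisymmetric identity in four basis vectors to the increasing index
  quadruples: adjacent transpositions sort the indices, and they bring a repeated index to the
  front.\<close>

lemma sorted_quadruples:
  fixes P :: "'b::linorder \<Rightarrow> 'b \<Rightarrow> 'b \<Rightarrow> 'b \<Rightarrow> bool"
  assumes s1: "\<And>i j k l. P i j k l \<Longrightarrow> P j i k l" and s2: "\<And>i j k l. P i j k l \<Longrightarrow> P i k j l"
    and s3: "\<And>i j k l. P i j k l \<Longrightarrow> P i j l k"
    and rep: "\<And>i k l. P i i k l"
    and sorted: "\<And>i j k l. i < j \<Longrightarrow> j < k \<Longrightarrow> k < l \<Longrightarrow> P i j k l"
  shows "P i j k l"
proof -
  have last: "P i j k l" if "i < j" "j < k" for i j k l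
    using that s1 s2 s3 rep sorted by (metis linorder_less_linear)
  show ?thesis
    using sorted_triples[of "\<lambda>i j k. P i j k l" i j k] s1 s2 rep last by blast
qed

lemma hodge_basis_combinations:
  "hodge_basis G e p \<omega> vs = (\<Sum>l\<leftarrow>combinations p [0,1,2,3,4,5,6,7].
     \<omega> (map e l) * wedge_covectors (map (dual_basis G e) [0,1,2,3,4,5,6,7]) (map e l @ vs))"
proof -
  have "{I :: 8 set. card I = p} = {I. I \<subseteq> set [0,1,2,3,4,5,6,7] \<and> card I = p}"
    using UNIV_8 by simp
  then show ?thesis
    unfolding hodge_basis_def using sum_combinations[OF sorted_indices_8,
      where p = p and f = "\<lambda>l. \<omega> (map e l) * wedge_covectors (map (dual_basis G e) [0,1,2,3,4,5,6,7]) (map e l @ vs)"]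
    by (simp only:)
qed

section \<open>Adapted bases\<close>

text \<open>Polarisation of \<open>\<omega> [u + v, u + v] = 0\<close>.\<close>

lemma alternating_2_swap:
  fixes \<omega> :: "'v::real_vector list \<Rightarrow> real"
  assumes "alternating_form 2 \<omega>"
  shows "\<omega> [v, u] = - \<omega> [u, v]" and "\<omega> [v, v] = 0"
proof -
  have lin: "linear (\<lambda>v. \<omega> ([u, w][i := v]))" if "i < 2" for u w i
    using assms that unfolding alternating_form_def multilinear_form_def
    by (metis length_Cons list.size(3) numeral_2_eq_2)
  have rep: "\<omega> [v, v] = 0" for v
    using assms unfolding alternating_form_def by simp
  have lin1: "linear (\<lambda>v. \<omega> [v, w])" and lin2: "linear (\<lambda>w. \<omega> [v, w])" for v w
    using lin[of 0] lin[of 1] by simp_all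
  show "\<omega> [v, v] = 0" by (rule rep)
  show "\<omega> [v, u] = - \<omega> [u, v]"
    using rep[of "u + v"] rep[of u] rep[of v] by (simp add: linear_add[OF lin1] linear_add[OF lin2])
qed

locale adapted =
  fixes G F :: "(real^8) list \<Rightarrow> real" and e :: "8 \<Rightarrow> real^8"
  assumes G_multilinear: "multilinear_form 2 G"
    and G_sym: "\<And>u v. G [u, v] = G [v, u]"
    and F_alternating: "alternating_form 4 F"
    and basis: "adapted_basis G F e"
begin

lemma G_basis: "G [e i, e j] = (if i = j then 1 else 0)"
  using basis by (simp add: adapted_basis_def)

lemma linear_G1: "linear (\<lambda>v. G [v, w])" and linear_G2: "linear (\<lambda>w. G [v, w])"
proof -
  have "linear (\<lambda>v. G ([u, w][i := v]))" if "i < 2" for u w i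
    using G_multilinear that unfolding multilinear_form_def by (metis length_Cons list.size(3) numeral_2_eq_2)
  from this[of 0] this[of 1] show "linear (\<lambda>v. G [v, w])" "linear (\<lambda>w. G [v, w])" by simp_all
qed

lemma F_multilinear:
  assumes "i < 4"
  shows "linear (\<lambda>v. F ([a, b, c, d][i := v]))"
proof -
  have "length [a, b, c, d] = 4" by simp
  then show ?thesis
    using F_alternating assms unfolding alternating_form_def multilinear_form_def by blast
qed

lemma linear_F1: "linear (\<lambda>v. F [v, b, c, d])" and linear_F2: "linear (\<lambda>v. F [a, v, c, d])"
  and linear_F3: "linear (\<lambda>v. F [a, b, v, d])" and linear_F4: "linear (\<lambda>v. F [a, b, c, v])"
  using F_multilinear[of 0] F_multilinear[of 1] F_multilinear[of 2] F_multilinear[of 3]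
  by (simp_all add: numeral_2_eq_2 numeral_3_eq_3)

lemma F_repeated: "F [a, a, c, d] = 0" "F [a, b, b, d] = 0" "F [a, b, c, c] = 0"
  using F_alternating unfolding alternating_form_def by simp_all

lemma F_swap: "F [b, a, c, d] = - F [a, b, c, d]" "F [a, c, b, d] = - F [a, b, c, d]"
  "F [a, b, d, c] = - F [a, b, c, d]"
proof -
  have antisym: "f y x = - f x y" if "\<And>x. f x x = 0" "\<And>y. linear (\<lambda>x. f x y)" "\<And>x. linear (f x)"
    for f :: "real^8 \<Rightarrow> real^8 \<Rightarrow> real" and x y
    using that(1)[of "x + y"] that(1)[of x] that(1)[of y]
      linear_add[OF that(2)] linear_add[OF that(3)] by simp
  show "F [b, a, c, d] = - F [a, b, c, d]" "F [a, c, b, d] = - F [a, b, c, d]"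
      "F [a, b, d, c] = - F [a, b, c, d]"
    using antisym[of "\<lambda>x y. F [x, y, c, d]" b a] antisym[of "\<lambda>x y. F [a, x, y, d]" c b]
      antisym[of "\<lambda>x y. F [a, b, x, y]" d c] F_repeated linear_F1 linear_F2 linear_F3 linear_F4
    by simp_all
qed

text \<open>Contraction rules peel basis vectors off the front of the argument list. Moving the
  arbitrary vector \<open>v\<close> to the end, at the cost of three transpositions, leaves a single
  covector evaluated at \<open>v\<close>.\<close>

lemma F_rotate: "F [v, a, b, c] = - F [a, b, c, v]"
  using F_swap(1)[of v a b c] F_swap(2)[of a v b c] F_swap(3)[of a b v c] by simp

lemma F_repeated': "F [v, a, b, a] = 0" "F [a, b, a, c] = 0" "F [a, b, c, a] = 0"
  using F_swap(3)[of v a b a] F_repeated F_swap(1)[of a b a c] F_swap(2)[of b a c a] F_rotate[of a b c a]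
    F_swap(2)[of a b a c] F_swap(3)[of a b c a]
  by simp_all

lemma span_basis: "span (range e) = UNIV"
proof -
  have inj: "inj e"
    using G_basis by (intro injI) (metis zero_neq_one)
  have "independent (range e)"
    unfolding dependent_explicit
  proof (clarify)
    fix T u v assume T: "finite T" "T \<subseteq> range e" and v: "v \<in> T" "u v \<noteq> 0"
      and sum: "(\<Sum>v\<in>T. u v *\<^sub>R v) = 0"
    obtain k where k: "v = e k" using T v by auto
    have "0 = G [e k, \<Sum>v\<in>T. u v *\<^sub>R v]" unfolding sum using linear_0[OF linear_G2] by simp
    also have "\<dots> = (\<Sum>v\<in>T. u v * G [e k, v])"
      by (simp add: linear_sum[OF linear_G2] linear_cmul[OF linear_G2])
    also have "\<dots> = (\<Sum>w\<in>T. if w = v then u v else 0)"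
      by (rule sum.cong[OF refl]) (use T k inj in \<open>auto simp: G_basis inj_eq\<close>)
    also have "\<dots> = u v" using T v by simp
    finally show False using v by simp
  qed
  moreover have "card (range e) = DIM(real^8)" using inj by (simp add: card_image)
  ultimately show ?thesis
    using card_ge_dim_independent[of "range e" UNIV] by auto
qed

lemma linear_eq_on_basis:
  fixes f g :: "real^8 \<Rightarrow> 'w::real_vector"
  assumes "linear f" "linear g" "\<And>i. f (e i) = g (e i)"
  shows "f v = g v"
  by (rule linear_eq_on_span[of f g "range e" v]) (use assms span_basis in auto)

lemma expand: "v = (\<Sum>i\<in>UNIV. G [e i, v] *\<^sub>R e i)"
proof (rule linear_eq_on_basis[of "\<lambda>v. v" "\<lambda>v. \<Sum>i\<in>UNIV. G [e i, v] *\<^sub>R e i"])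
  show "linear (\<lambda>v. \<Sum>i\<in>UNIV. G [e i, v] *\<^sub>R e i)"
    by (intro linear_compose_sum ballI linear_compose[OF linear_G2, unfolded o_def] linear_scale_left)
  show "e j = (\<Sum>i\<in>UNIV. G [e i, e j] *\<^sub>R e i)" for j
    by (simp add: G_basis if_distrib[of "\<lambda>r. r *\<^sub>R _"] cong: if_cong)
qed (simp add: linear_iff)

lemma G_nondegenerate: "(\<And>i. G [e i, v] = G [e i, w]) \<Longrightarrow> v = w"
  using expand[of v] expand[of w] by simp

lemma coframe_basis: "dual_basis G e i (e j) = (if i = j then 1 else 0)"
  by (simp add: dual_basis_def G_basis)

lemma coframe_singleton: "coframe_wedge (dual_basis G e) [i] [v] = G [e i, v]"
  by (simp add: coframe_wedge_singleton dual_basis_def)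

lemmas coframe_simps = coframe_wedge_basis_Cons[where \<epsilon> = "dual_basis G e" and e = e, OF coframe_basis]

lemma spin7_form_coframe:
  "spin7_form \<epsilon> vs = (let E = (\<lambda>is. coframe_wedge \<epsilon> is vs) in
     E [0,1,2,3] - E [0,1,4,5] - E [0,1,6,7] - E [0,2,4,6] + E [0,2,5,7] - E [0,3,4,7] - E [0,3,5,6]
     + E [4,5,6,7] - E [2,3,6,7] - E [2,3,4,5] - E [1,3,5,7] + E [1,3,4,6] - E [1,2,5,6] - E [1,2,4,7])"
  unfolding spin7_form_def coframe_wedge_def by (rule refl)

lemma F_coframe: "length vs = 4 \<Longrightarrow> F vs = spin7_form (dual_basis G e) vs"
  using basis by (simp add: adapted_basis_def)

text \<open>The 14 quadruples form a Steiner system \<open>S(3, 4, 8)\<close>: each triple of indices lies in exactly one of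
  them, so every right-hand side consists of a single term.\<close>

lemma F_basis_triples:
  "F [v, e 0, e 1, e 2] = - G [e 3, v]"
  "F [v, e 0, e 1, e 3] = G [e 2, v]"
  "F [v, e 0, e 1, e 4] = G [e 5, v]"
  "F [v, e 0, e 1, e 5] = - G [e 4, v]"
  "F [v, e 0, e 1, e 6] = G [e 7, v]"
  "F [v, e 0, e 1, e 7] = - G [e 6, v]"
  "F [v, e 0, e 2, e 3] = - G [e 1, v]"
  "F [v, e 0, e 2, e 4] = G [e 6, v]"
  "F [v, e 0, e 2, e 5] = - G [e 7, v]"
  "F [v, e 0, e 2, e 6] = - G [e 4, v]"
  "F [v, e 0, e 2, e 7] = G [e 5, v]"
  "F [v, e 0, e 3, e 4] = G [e 7, v]"
  "F [v, e 0, e 3, e 5] = G [e 6, v]"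
  "F [v, e 0, e 3, e 6] = - G [e 5, v]"
  "F [v, e 0, e 3, e 7] = - G [e 4, v]"
  "F [v, e 0, e 4, e 5] = G [e 1, v]"
  "F [v, e 0, e 4, e 6] = G [e 2, v]"
  "F [v, e 0, e 4, e 7] = G [e 3, v]"
  "F [v, e 0, e 5, e 6] = G [e 3, v]"
  "F [v, e 0, e 5, e 7] = - G [e 2, v]"
  "F [v, e 0, e 6, e 7] = G [e 1, v]"
  "F [v, e 1, e 2, e 3] = G [e 0, v]"
  "F [v, e 1, e 2, e 4] = G [e 7, v]"
  "F [v, e 1, e 2, e 5] = G [e 6, v]"
  "F [v, e 1, e 2, e 6] = - G [e 5, v]"
  "F [v, e 1, e 2, e 7] = - G [e 4, v]"
  "F [v, e 1, e 3, e 4] = - G [e 6, v]"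
  "F [v, e 1, e 3, e 5] = G [e 7, v]"
  "F [v, e 1, e 3, e 6] = G [e 4, v]"
  "F [v, e 1, e 3, e 7] = - G [e 5, v]"
  "F [v, e 1, e 4, e 5] = - G [e 0, v]"
  "F [v, e 1, e 4, e 6] = - G [e 3, v]"
  "F [v, e 1, e 4, e 7] = G [e 2, v]"
  "F [v, e 1, e 5, e 6] = G [e 2, v]"
  "F [v, e 1, e 5, e 7] = G [e 3, v]"
  "F [v, e 1, e 6, e 7] = - G [e 0, v]"
  "F [v, e 2, e 3, e 4] = G [e 5, v]"
  "F [v, e 2, e 3, e 5] = - G [e 4, v]"
  "F [v, e 2, e 3, e 6] = G [e 7, v]"
  "F [v, e 2, e 3, e 7] = - G [e 6, v]"
  "F [v, e 2, e 4, e 5] = G [e 3, v]"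
  "F [v, e 2, e 4, e 6] = - G [e 0, v]"
  "F [v, e 2, e 4, e 7] = - G [e 1, v]"
  "F [v, e 2, e 5, e 6] = - G [e 1, v]"
  "F [v, e 2, e 5, e 7] = G [e 0, v]"
  "F [v, e 2, e 6, e 7] = G [e 3, v]"
  "F [v, e 3, e 4, e 5] = - G [e 2, v]"
  "F [v, e 3, e 4, e 6] = G [e 1, v]"
  "F [v, e 3, e 4, e 7] = - G [e 0, v]"
  "F [v, e 3, e 5, e 6] = - G [e 0, v]"
  "F [v, e 3, e 5, e 7] = - G [e 1, v]"
  "F [v, e 3, e 6, e 7] = - G [e 2, v]"
  "F [v, e 4, e 5, e 6] = - G [e 7, v]"
  "F [v, e 4, e 5, e 7] = G [e 6, v]"
  "F [v, e 4, e 6, e 7] = - G [e 5, v]"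
  "F [v, e 5, e 6, e 7] = G [e 4, v]"
  unfolding F_rotate[of v]
  by (simp_all add: F_coframe spin7_form_coframe Let_def coframe_simps coframe_singleton)

section \<open>The eigenspaces of the star operator on 2-forms\<close>

lemma wedge_4_2:
  "wedge 4 \<alpha> \<beta> [a, b, c, d, x, y] =
    \<alpha> [a, b, c, d] * \<beta> [x, y]
     - \<alpha> [a, b, c, x] * \<beta> [d, y]
     + \<alpha> [a, b, c, y] * \<beta> [d, x]
     + \<alpha> [a, b, d, x] * \<beta> [c, y]
     - \<alpha> [a, b, d, y] * \<beta> [c, x]
     + \<alpha> [a, b, x, y] * \<beta> [c, d]
     - \<alpha> [a, c, d, x] * \<beta> [b, y]
     + \<alpha> [a, c, d, y] * \<beta> [b, x]
     - \<alpha> [a, c, x, y] * \<beta> [b, d]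
     + \<alpha> [a, d, x, y] * \<beta> [b, c]
     + \<alpha> [b, c, d, x] * \<beta> [a, y]
     - \<alpha> [b, c, d, y] * \<beta> [a, x]
     + \<alpha> [b, c, x, y] * \<beta> [a, d]
     - \<alpha> [b, d, x, y] * \<beta> [a, c]
     + \<alpha> [c, d, x, y] * \<beta> [a, b]"
  by (simp add: eval_nat_numeral wedge_Cons wedge_0 wedge_Nil)

lemma hodge_6:
  assumes "length vs = 2"
  shows "hodge_basis G e 6 X vs =
    X [e 0, e 1, e 2, e 3, e 4, e 5] * coframe_wedge (dual_basis G e) [6, 7] vs
     - X [e 0, e 1, e 2, e 3, e 4, e 6] * coframe_wedge (dual_basis G e) [5, 7] vs
     + X [e 0, e 1, e 2, e 3, e 4, e 7] * coframe_wedge (dual_basis G e) [5, 6] vs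
     + X [e 0, e 1, e 2, e 3, e 5, e 6] * coframe_wedge (dual_basis G e) [4, 7] vs
     - X [e 0, e 1, e 2, e 3, e 5, e 7] * coframe_wedge (dual_basis G e) [4, 6] vs
     + X [e 0, e 1, e 2, e 3, e 6, e 7] * coframe_wedge (dual_basis G e) [4, 5] vs
     - X [e 0, e 1, e 2, e 4, e 5, e 6] * coframe_wedge (dual_basis G e) [3, 7] vs
     + X [e 0, e 1, e 2, e 4, e 5, e 7] * coframe_wedge (dual_basis G e) [3, 6] vs
     - X [e 0, e 1, e 2, e 4, e 6, e 7] * coframe_wedge (dual_basis G e) [3, 5] vs
     + X [e 0, e 1, e 2, e 5, e 6, e 7] * coframe_wedge (dual_basis G e) [3, 4] vs
     + X [e 0, e 1, e 3, e 4, e 5, e 6] * coframe_wedge (dual_basis G e) [2, 7] vs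
     - X [e 0, e 1, e 3, e 4, e 5, e 7] * coframe_wedge (dual_basis G e) [2, 6] vs
     + X [e 0, e 1, e 3, e 4, e 6, e 7] * coframe_wedge (dual_basis G e) [2, 5] vs
     - X [e 0, e 1, e 3, e 5, e 6, e 7] * coframe_wedge (dual_basis G e) [2, 4] vs
     + X [e 0, e 1, e 4, e 5, e 6, e 7] * coframe_wedge (dual_basis G e) [2, 3] vs
     - X [e 0, e 2, e 3, e 4, e 5, e 6] * coframe_wedge (dual_basis G e) [1, 7] vs
     + X [e 0, e 2, e 3, e 4, e 5, e 7] * coframe_wedge (dual_basis G e) [1, 6] vs
     - X [e 0, e 2, e 3, e 4, e 6, e 7] * coframe_wedge (dual_basis G e) [1, 5] vs
     + X [e 0, e 2, e 3, e 5, e 6, e 7] * coframe_wedge (dual_basis G e) [1, 4] vs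
     - X [e 0, e 2, e 4, e 5, e 6, e 7] * coframe_wedge (dual_basis G e) [1, 3] vs
     + X [e 0, e 3, e 4, e 5, e 6, e 7] * coframe_wedge (dual_basis G e) [1, 2] vs
     + X [e 1, e 2, e 3, e 4, e 5, e 6] * coframe_wedge (dual_basis G e) [0, 7] vs
     - X [e 1, e 2, e 3, e 4, e 5, e 7] * coframe_wedge (dual_basis G e) [0, 6] vs
     + X [e 1, e 2, e 3, e 4, e 6, e 7] * coframe_wedge (dual_basis G e) [0, 5] vs
     - X [e 1, e 2, e 3, e 5, e 6, e 7] * coframe_wedge (dual_basis G e) [0, 4] vs
     + X [e 1, e 2, e 4, e 5, e 6, e 7] * coframe_wedge (dual_basis G e) [0, 3] vs
     - X [e 1, e 3, e 4, e 5, e 6, e 7] * coframe_wedge (dual_basis G e) [0, 2] vs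
     + X [e 2, e 3, e 4, e 5, e 6, e 7] * coframe_wedge (dual_basis G e) [0, 1] vs"
  using assms unfolding hodge_basis_combinations coframe_wedge_def[symmetric]
  by (simp add: eval_nat_numeral coframe_simps)

lemma coframe_wedge_pair:
  "coframe_wedge (dual_basis G e) [i, j] [u, v] = G [e i, u] * G [e j, v] - G [e i, v] * G [e j, u]"
  by (simp add: coframe_wedge_def wedge_Cons wedge_0 wedge_Nil dual_basis_def)

text \<open>By self-duality of the 4-form, the operator contracts \<omega> with \<open>F\<close>. A
  pair of indices lies in exactly three of the 14 quadruples, hence the three terms. The four pairs
  with the same index sum in (Z/2)^3 form a block invariant under the operator.\<close>

lemma star_pairs:
  "hodge_basis G e 6 (wedge 4 F \<omega>) [e 0, e 1] = - \<omega> [e 6, e 7] - \<omega> [e 4, e 5] + \<omega> [e 2, e 3]"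
  "hodge_basis G e 6 (wedge 4 F \<omega>) [e 0, e 2] = \<omega> [e 5, e 7] - \<omega> [e 4, e 6] - \<omega> [e 1, e 3]"
  "hodge_basis G e 6 (wedge 4 F \<omega>) [e 0, e 3] = - \<omega> [e 5, e 6] - \<omega> [e 4, e 7] + \<omega> [e 1, e 2]"
  "hodge_basis G e 6 (wedge 4 F \<omega>) [e 0, e 4] = \<omega> [e 3, e 7] + \<omega> [e 2, e 6] + \<omega> [e 1, e 5]"
  "hodge_basis G e 6 (wedge 4 F \<omega>) [e 0, e 5] = \<omega> [e 3, e 6] - \<omega> [e 2, e 7] - \<omega> [e 1, e 4]"
  "hodge_basis G e 6 (wedge 4 F \<omega>) [e 0, e 6] = - \<omega> [e 3, e 5] - \<omega> [e 2, e 4] + \<omega> [e 1, e 7]"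
  "hodge_basis G e 6 (wedge 4 F \<omega>) [e 0, e 7] = - \<omega> [e 3, e 4] + \<omega> [e 2, e 5] - \<omega> [e 1, e 6]"
  "hodge_basis G e 6 (wedge 4 F \<omega>) [e 1, e 2] = - \<omega> [e 5, e 6] - \<omega> [e 4, e 7] + \<omega> [e 0, e 3]"
  "hodge_basis G e 6 (wedge 4 F \<omega>) [e 1, e 3] = - \<omega> [e 5, e 7] + \<omega> [e 4, e 6] - \<omega> [e 0, e 2]"
  "hodge_basis G e 6 (wedge 4 F \<omega>) [e 1, e 4] = - \<omega> [e 3, e 6] + \<omega> [e 2, e 7] - \<omega> [e 0, e 5]"
  "hodge_basis G e 6 (wedge 4 F \<omega>) [e 1, e 5] = \<omega> [e 3, e 7] + \<omega> [e 2, e 6] + \<omega> [e 0, e 4]"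
  "hodge_basis G e 6 (wedge 4 F \<omega>) [e 1, e 6] = \<omega> [e 3, e 4] - \<omega> [e 2, e 5] - \<omega> [e 0, e 7]"
  "hodge_basis G e 6 (wedge 4 F \<omega>) [e 1, e 7] = - \<omega> [e 3, e 5] - \<omega> [e 2, e 4] + \<omega> [e 0, e 6]"
  "hodge_basis G e 6 (wedge 4 F \<omega>) [e 2, e 3] = - \<omega> [e 6, e 7] - \<omega> [e 4, e 5] + \<omega> [e 0, e 1]"
  "hodge_basis G e 6 (wedge 4 F \<omega>) [e 2, e 4] = \<omega> [e 3, e 5] - \<omega> [e 1, e 7] - \<omega> [e 0, e 6]"
  "hodge_basis G e 6 (wedge 4 F \<omega>) [e 2, e 5] = - \<omega> [e 3, e 4] - \<omega> [e 1, e 6] + \<omega> [e 0, e 7]"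
  "hodge_basis G e 6 (wedge 4 F \<omega>) [e 2, e 6] = \<omega> [e 3, e 7] + \<omega> [e 1, e 5] + \<omega> [e 0, e 4]"
  "hodge_basis G e 6 (wedge 4 F \<omega>) [e 2, e 7] = - \<omega> [e 3, e 6] + \<omega> [e 1, e 4] - \<omega> [e 0, e 5]"
  "hodge_basis G e 6 (wedge 4 F \<omega>) [e 3, e 4] = - \<omega> [e 2, e 5] + \<omega> [e 1, e 6] - \<omega> [e 0, e 7]"
  "hodge_basis G e 6 (wedge 4 F \<omega>) [e 3, e 5] = \<omega> [e 2, e 4] - \<omega> [e 1, e 7] - \<omega> [e 0, e 6]"
  "hodge_basis G e 6 (wedge 4 F \<omega>) [e 3, e 6] = - \<omega> [e 2, e 7] - \<omega> [e 1, e 4] + \<omega> [e 0, e 5]"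
  "hodge_basis G e 6 (wedge 4 F \<omega>) [e 3, e 7] = \<omega> [e 2, e 6] + \<omega> [e 1, e 5] + \<omega> [e 0, e 4]"
  "hodge_basis G e 6 (wedge 4 F \<omega>) [e 4, e 5] = \<omega> [e 6, e 7] - \<omega> [e 2, e 3] - \<omega> [e 0, e 1]"
  "hodge_basis G e 6 (wedge 4 F \<omega>) [e 4, e 6] = - \<omega> [e 5, e 7] + \<omega> [e 1, e 3] - \<omega> [e 0, e 2]"
  "hodge_basis G e 6 (wedge 4 F \<omega>) [e 4, e 7] = \<omega> [e 5, e 6] - \<omega> [e 1, e 2] - \<omega> [e 0, e 3]"
  "hodge_basis G e 6 (wedge 4 F \<omega>) [e 5, e 6] = \<omega> [e 4, e 7] - \<omega> [e 1, e 2] - \<omega> [e 0, e 3]"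
  "hodge_basis G e 6 (wedge 4 F \<omega>) [e 5, e 7] = - \<omega> [e 4, e 6] - \<omega> [e 1, e 3] + \<omega> [e 0, e 2]"
  "hodge_basis G e 6 (wedge 4 F \<omega>) [e 6, e 7] = \<omega> [e 4, e 5] - \<omega> [e 2, e 3] - \<omega> [e 0, e 1]"
  by (simp_all add: hodge_6 coframe_wedge_pair G_basis wedge_4_2 F_basis_triples)

text \<open>In each of the seven blocks of four pairs the eigenvalue 3 is simple, so one component
  determines the other three. The component containing index 0 is kept, which gives seven
  coordinates on \<open>\<Lambda>\<^sup>2\<^sub>7\<close>.\<close>

lemma Lambda2_7_relations:
  assumes "\<And>u v. hodge_basis G e 6 (wedge 4 F \<omega>) [u, v] = 3 * \<omega> [u, v]"
  shows
    "\<omega> [e 6, e 7] = - \<omega> [e 0, e 1]"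
    "\<omega> [e 5, e 7] = \<omega> [e 0, e 2]"
    "\<omega> [e 5, e 6] = - \<omega> [e 0, e 3]"
    "\<omega> [e 4, e 7] = - \<omega> [e 0, e 3]"
    "\<omega> [e 4, e 6] = - \<omega> [e 0, e 2]"
    "\<omega> [e 4, e 5] = - \<omega> [e 0, e 1]"
    "\<omega> [e 3, e 7] = \<omega> [e 0, e 4]"
    "\<omega> [e 3, e 6] = \<omega> [e 0, e 5]"
    "\<omega> [e 3, e 5] = - \<omega> [e 0, e 6]"
    "\<omega> [e 3, e 4] = - \<omega> [e 0, e 7]"
    "\<omega> [e 2, e 7] = - \<omega> [e 0, e 5]"
    "\<omega> [e 2, e 6] = \<omega> [e 0, e 4]"
    "\<omega> [e 2, e 5] = \<omega> [e 0, e 7]"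
    "\<omega> [e 2, e 4] = - \<omega> [e 0, e 6]"
    "\<omega> [e 2, e 3] = \<omega> [e 0, e 1]"
    "\<omega> [e 1, e 7] = \<omega> [e 0, e 6]"
    "\<omega> [e 1, e 6] = - \<omega> [e 0, e 7]"
    "\<omega> [e 1, e 5] = \<omega> [e 0, e 4]"
    "\<omega> [e 1, e 4] = - \<omega> [e 0, e 5]"
    "\<omega> [e 1, e 3] = - \<omega> [e 0, e 2]"
    "\<omega> [e 1, e 2] = \<omega> [e 0, e 3]"
  using star_pairs[of \<omega>, unfolded assms] by linarith+

text \<open>In each block the eigenvalue -1 has multiplicity three, so it imposes one relation per
  block; 28 components and 7 relations leave dimension 21.\<close>

lemma Lambda2_21_relations:
  assumes "\<And>u v. hodge_basis G e 6 (wedge 4 F \<omega>) [u, v] = - \<omega> [u, v]"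
  shows
    "\<omega> [e 6, e 7] = - \<omega> [e 4, e 5] + \<omega> [e 2, e 3] + \<omega> [e 0, e 1]"
    "\<omega> [e 5, e 7] = \<omega> [e 4, e 6] + \<omega> [e 1, e 3] - \<omega> [e 0, e 2]"
    "\<omega> [e 5, e 6] = - \<omega> [e 4, e 7] + \<omega> [e 1, e 2] + \<omega> [e 0, e 3]"
    "\<omega> [e 3, e 7] = - \<omega> [e 2, e 6] - \<omega> [e 1, e 5] - \<omega> [e 0, e 4]"
    "\<omega> [e 3, e 6] = \<omega> [e 2, e 7] + \<omega> [e 1, e 4] - \<omega> [e 0, e 5]"
    "\<omega> [e 3, e 5] = - \<omega> [e 2, e 4] + \<omega> [e 1, e 7] + \<omega> [e 0, e 6]"
    "\<omega> [e 3, e 4] = \<omega> [e 2, e 5] - \<omega> [e 1, e 6] + \<omega> [e 0, e 7]"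
  using star_pairs[of \<omega>, unfolded assms] by linarith+

section \<open>The intrinsic torsion at a point\<close>

lemma F_triple_swap:
  "F [v, a, b, c] = r \<Longrightarrow> F [v, b, a, c] = - r" "F [v, a, b, c] = r \<Longrightarrow> F [v, a, c, b] = - r"
  by (simp_all add: F_swap(2)[of v b a c] F_swap(3)[of v a c b])

text \<open>All six orders of the three basis vectors, so that rewriting evaluates a triple in
  whatever order it occurs.\<close>

lemmas F_basis_triples_permuted = F_basis_triples F_basis_triples[THEN F_triple_swap(1)] F_basis_triples[THEN F_triple_swap(2)]
  F_basis_triples[THEN F_triple_swap(1), THEN F_triple_swap(2)] F_basis_triples[THEN F_triple_swap(2), THEN F_triple_swap(1)]
  F_basis_triples[THEN F_triple_swap(1), THEN F_triple_swap(2), THEN F_triple_swap(1)]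

lemma G_orthogonal:
  "G [e 0, e 0] = 1" "G [e 0, e 1] = 0" "G [e 0, e 2] = 0" "G [e 0, e 3] = 0" "G [e 0, e 4] = 0" "G [e 0, e 5] = 0" "G [e 0, e 6] = 0" "G [e 0, e 7] = 0"
  "G [e 1, e 0] = 0" "G [e 1, e 1] = 1" "G [e 1, e 2] = 0" "G [e 1, e 3] = 0" "G [e 1, e 4] = 0" "G [e 1, e 5] = 0" "G [e 1, e 6] = 0" "G [e 1, e 7] = 0"
  "G [e 2, e 0] = 0" "G [e 2, e 1] = 0" "G [e 2, e 2] = 1" "G [e 2, e 3] = 0" "G [e 2, e 4] = 0" "G [e 2, e 5] = 0" "G [e 2, e 6] = 0" "G [e 2, e 7] = 0"
  "G [e 3, e 0] = 0" "G [e 3, e 1] = 0" "G [e 3, e 2] = 0" "G [e 3, e 3] = 1" "G [e 3, e 4] = 0" "G [e 3, e 5] = 0" "G [e 3, e 6] = 0" "G [e 3, e 7] = 0"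
  "G [e 4, e 0] = 0" "G [e 4, e 1] = 0" "G [e 4, e 2] = 0" "G [e 4, e 3] = 0" "G [e 4, e 4] = 1" "G [e 4, e 5] = 0" "G [e 4, e 6] = 0" "G [e 4, e 7] = 0"
  "G [e 5, e 0] = 0" "G [e 5, e 1] = 0" "G [e 5, e 2] = 0" "G [e 5, e 3] = 0" "G [e 5, e 4] = 0" "G [e 5, e 5] = 1" "G [e 5, e 6] = 0" "G [e 5, e 7] = 0"
  "G [e 6, e 0] = 0" "G [e 6, e 1] = 0" "G [e 6, e 2] = 0" "G [e 6, e 3] = 0" "G [e 6, e 4] = 0" "G [e 6, e 5] = 0" "G [e 6, e 6] = 1" "G [e 6, e 7] = 0"
  "G [e 7, e 0] = 0" "G [e 7, e 1] = 0" "G [e 7, e 2] = 0" "G [e 7, e 3] = 0" "G [e 7, e 4] = 0" "G [e 7, e 5] = 0" "G [e 7, e 6] = 0" "G [e 7, e 7] = 1"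
  by (simp_all add: G_basis)

text \<open>The hypothesis \<open>torsion\<close> is the equation
  \<open>d\<Phi> = \<theta> \<and> \<Phi>\<close> after the derivatives of the 4-form have been
  expressed by \<open>T\<close>. A 5-tuple of distinct indices contains exactly one quadruple of the
  4-form; if k is its remaining index, only the term with \<open>\<theta> (e k)\<close> survives on
  the right. On the left only those \<open>c a 0 b\<close> survive for which a + b = k in (Z/2)^3.
  For each k there are seven such unknowns and seven such 5-tuples.\<close>

lemma contorsion_formula:
  fixes C :: "real^8 \<Rightarrow> real^8 \<Rightarrow> real^8" and \<theta> :: "real^8 \<Rightarrow> real"
  defines "T \<equiv> \<lambda>u v. C u v - C v u"
  assumes C: "bilinear C" and \<theta>: "linear \<theta>"
    and alternating: "\<And>u. alternating_form 2 (form_of_endo G (C u))"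
    and star: "\<And>u x y. hodge_basis G e 6 (wedge 4 F (form_of_endo G (C u))) [x, y] =
      3 * form_of_endo G (C u) [x, y]"
    and torsion: "\<And>a b c d f.
      - F [T a b, c, d, f] + F [T a c, b, d, f] - F [T a d, b, c, f] + F [T a f, b, c, d]
      - F [T b c, a, d, f] + F [T b d, a, c, f] - F [T b f, a, c, d]
      - F [T c d, a, b, f] + F [T c f, a, b, d] - F [T d f, a, b, c] =
      \<theta> a * F [b, c, d, f] - \<theta> b * F [a, c, d, f] + \<theta> c * F [a, b, d, f]
      - \<theta> d * F [a, b, c, f] + \<theta> f * F [a, b, c, d]"
  shows "G [C u v, w] =
    (\<theta> v * G [u, w] - \<theta> w * G [u, v] + F [\<Sum>i\<in>UNIV. \<theta> (e i) *\<^sub>R e i, u, v, w]) / 16"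
proof -
  define t where "t = (\<Sum>i\<in>UNIV. \<theta> (e i) *\<^sub>R e i)"
  define c where "c a b m = G [e m, C (e a) (e b)]" for a b m
  have C1: "linear (\<lambda>u. C u v)" and C2: "linear (C u)" for u v
    using C by (simp_all add: bilinear_def)
  have G_diff: "G [x, y - z] = G [x, y] - G [x, z]" for x y z
    by (rule linear_diff[OF linear_G2])
  have c: "form_of_endo G (C (e a)) [e b, e m] = c a b m" for a b m
    by (simp add: form_of_endo_def c_def G_sym)
  have swap: "c a m b = - c a b m" and diag: "c a b b = 0" for a b m
    unfolding c[symmetric] using alternating by (rule alternating_2_swap)+
  \<comment> \<open>Only decreasing pairs are exchanged: rewriting then ends with the smaller index
    in front, whereas the general rule would loop.\<close>
  note swaps =
    swap[of _ 1 0]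
    swap[of _ 2 0]
    swap[of _ 3 0]
    swap[of _ 4 0]
    swap[of _ 5 0]
    swap[of _ 6 0]
    swap[of _ 7 0]
    swap[of _ 2 1]
    swap[of _ 3 1]
    swap[of _ 4 1]
    swap[of _ 5 1]
    swap[of _ 6 1]
    swap[of _ 7 1]
    swap[of _ 3 2]
    swap[of _ 4 2]
    swap[of _ 5 2]
    swap[of _ 6 2]
    swap[of _ 7 2]
    swap[of _ 4 3]
    swap[of _ 5 3]
    swap[of _ 6 3]
    swap[of _ 7 3]
    swap[of _ 5 4]
    swap[of _ 6 4]
    swap[of _ 7 4]
    swap[of _ 6 5]
    swap[of _ 7 5]
    swap[of _ 7 6]
  \<comment> \<open>Expresses every component in terms of the 56 unknowns \<open>c a 0 m\<close>
    with \<open>m\<close> different from 0.\<close>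
  note relations = Lambda2_7_relations[OF star, of "e _", unfolded c]
  note evaluate = T_def F_basis_triples G_diff c_def[symmetric] diag swaps relations G_orthogonal
  \<comment> \<open>The 56 equations split into eight systems of 7 equations in 7 unknowns, one for each component
    of \<open>\<theta>\<close>.\<close>
  have solution0:
    "c 1 0 1 = \<theta> (e 0) / 16"
    "c 2 0 2 = \<theta> (e 0) / 16"
    "c 3 0 3 = \<theta> (e 0) / 16"
    "c 4 0 4 = \<theta> (e 0) / 16"
    "c 5 0 5 = \<theta> (e 0) / 16"
    "c 6 0 6 = \<theta> (e 0) / 16"
    "c 7 0 7 = \<theta> (e 0) / 16"
    using
      torsion[of "e 0" "e 1" "e 2" "e 4" "e 7", unfolded evaluate]
      torsion[of "e 0" "e 1" "e 2" "e 5" "e 6", unfolded evaluate]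
      torsion[of "e 0" "e 1" "e 3" "e 4" "e 6", unfolded evaluate]
      torsion[of "e 0" "e 1" "e 3" "e 5" "e 7", unfolded evaluate]
      torsion[of "e 0" "e 2" "e 3" "e 4" "e 5", unfolded evaluate]
      torsion[of "e 0" "e 2" "e 3" "e 6" "e 7", unfolded evaluate]
      torsion[of "e 0" "e 4" "e 5" "e 6" "e 7", unfolded evaluate]
    by algebra+
  have solution1:
    "c 0 0 1 = - \<theta> (e 1) / 16"
    "c 2 0 3 = \<theta> (e 1) / 16"
    "c 3 0 2 = - \<theta> (e 1) / 16"
    "c 4 0 5 = - \<theta> (e 1) / 16"
    "c 5 0 4 = \<theta> (e 1) / 16"
    "c 6 0 7 = - \<theta> (e 1) / 16"
    "c 7 0 6 = \<theta> (e 1) / 16"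
    using
      torsion[of "e 0" "e 1" "e 2" "e 4" "e 6", unfolded evaluate]
      torsion[of "e 0" "e 1" "e 2" "e 5" "e 7", unfolded evaluate]
      torsion[of "e 0" "e 1" "e 3" "e 4" "e 7", unfolded evaluate]
      torsion[of "e 0" "e 1" "e 3" "e 5" "e 6", unfolded evaluate]
      torsion[of "e 1" "e 2" "e 3" "e 4" "e 5", unfolded evaluate]
      torsion[of "e 1" "e 2" "e 3" "e 6" "e 7", unfolded evaluate]
      torsion[of "e 1" "e 4" "e 5" "e 6" "e 7", unfolded evaluate]
    by algebra+
  have solution2:
    "c 0 0 2 = - \<theta> (e 2) / 16"
    "c 1 0 3 = - \<theta> (e 2) / 16"
    "c 3 0 1 = \<theta> (e 2) / 16"
    "c 4 0 6 = - \<theta> (e 2) / 16"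
    "c 5 0 7 = \<theta> (e 2) / 16"
    "c 6 0 4 = \<theta> (e 2) / 16"
    "c 7 0 5 = - \<theta> (e 2) / 16"
    using
      torsion[of "e 0" "e 1" "e 2" "e 4" "e 5", unfolded evaluate]
      torsion[of "e 0" "e 1" "e 2" "e 6" "e 7", unfolded evaluate]
      torsion[of "e 0" "e 2" "e 3" "e 4" "e 7", unfolded evaluate]
      torsion[of "e 0" "e 2" "e 3" "e 5" "e 6", unfolded evaluate]
      torsion[of "e 1" "e 2" "e 3" "e 4" "e 6", unfolded evaluate]
      torsion[of "e 1" "e 2" "e 3" "e 5" "e 7", unfolded evaluate]
      torsion[of "e 2" "e 4" "e 5" "e 6" "e 7", unfolded evaluate]
    by algebra+
  have solution3:
    "c 0 0 3 = - \<theta> (e 3) / 16"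
    "c 1 0 2 = \<theta> (e 3) / 16"
    "c 2 0 1 = - \<theta> (e 3) / 16"
    "c 4 0 7 = - \<theta> (e 3) / 16"
    "c 5 0 6 = - \<theta> (e 3) / 16"
    "c 6 0 5 = \<theta> (e 3) / 16"
    "c 7 0 4 = \<theta> (e 3) / 16"
    using
      torsion[of "e 0" "e 1" "e 3" "e 4" "e 5", unfolded evaluate]
      torsion[of "e 0" "e 1" "e 3" "e 6" "e 7", unfolded evaluate]
      torsion[of "e 0" "e 2" "e 3" "e 4" "e 6", unfolded evaluate]
      torsion[of "e 0" "e 2" "e 3" "e 5" "e 7", unfolded evaluate]
      torsion[of "e 1" "e 2" "e 3" "e 4" "e 7", unfolded evaluate]
      torsion[of "e 1" "e 2" "e 3" "e 5" "e 6", unfolded evaluate]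
      torsion[of "e 3" "e 4" "e 5" "e 6" "e 7", unfolded evaluate]
    by algebra+
  have solution4:
    "c 0 0 4 = - \<theta> (e 4) / 16"
    "c 1 0 5 = \<theta> (e 4) / 16"
    "c 2 0 6 = \<theta> (e 4) / 16"
    "c 3 0 7 = \<theta> (e 4) / 16"
    "c 5 0 1 = - \<theta> (e 4) / 16"
    "c 6 0 2 = - \<theta> (e 4) / 16"
    "c 7 0 3 = - \<theta> (e 4) / 16"
    using
      torsion[of "e 0" "e 1" "e 2" "e 3" "e 4", unfolded evaluate]
      torsion[of "e 0" "e 1" "e 4" "e 6" "e 7", unfolded evaluate]
      torsion[of "e 0" "e 2" "e 4" "e 5" "e 7", unfolded evaluate]
      torsion[of "e 0" "e 3" "e 4" "e 5" "e 6", unfolded evaluate]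
      torsion[of "e 1" "e 2" "e 4" "e 5" "e 6", unfolded evaluate]
      torsion[of "e 1" "e 3" "e 4" "e 5" "e 7", unfolded evaluate]
      torsion[of "e 2" "e 3" "e 4" "e 6" "e 7", unfolded evaluate]
    by algebra+
  have solution5:
    "c 0 0 5 = - \<theta> (e 5) / 16"
    "c 1 0 4 = - \<theta> (e 5) / 16"
    "c 2 0 7 = - \<theta> (e 5) / 16"
    "c 3 0 6 = \<theta> (e 5) / 16"
    "c 4 0 1 = \<theta> (e 5) / 16"
    "c 6 0 3 = - \<theta> (e 5) / 16"
    "c 7 0 2 = \<theta> (e 5) / 16"
    using
      torsion[of "e 0" "e 1" "e 2" "e 3" "e 5", unfolded evaluate]
      torsion[of "e 0" "e 1" "e 5" "e 6" "e 7", unfolded evaluate]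
      torsion[of "e 0" "e 2" "e 4" "e 5" "e 6", unfolded evaluate]
      torsion[of "e 0" "e 3" "e 4" "e 5" "e 7", unfolded evaluate]
      torsion[of "e 1" "e 2" "e 4" "e 5" "e 7", unfolded evaluate]
      torsion[of "e 1" "e 3" "e 4" "e 5" "e 6", unfolded evaluate]
      torsion[of "e 2" "e 3" "e 5" "e 6" "e 7", unfolded evaluate]
    by algebra+
  have solution6:
    "c 0 0 6 = - \<theta> (e 6) / 16"
    "c 1 0 7 = \<theta> (e 6) / 16"
    "c 2 0 4 = - \<theta> (e 6) / 16"
    "c 3 0 5 = - \<theta> (e 6) / 16"
    "c 4 0 2 = \<theta> (e 6) / 16"
    "c 5 0 3 = \<theta> (e 6) / 16"
    "c 7 0 1 = - \<theta> (e 6) / 16"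
    using
      torsion[of "e 0" "e 1" "e 2" "e 3" "e 6", unfolded evaluate]
      torsion[of "e 0" "e 1" "e 4" "e 5" "e 6", unfolded evaluate]
      torsion[of "e 0" "e 2" "e 5" "e 6" "e 7", unfolded evaluate]
      torsion[of "e 0" "e 3" "e 4" "e 6" "e 7", unfolded evaluate]
      torsion[of "e 1" "e 2" "e 4" "e 6" "e 7", unfolded evaluate]
      torsion[of "e 1" "e 3" "e 5" "e 6" "e 7", unfolded evaluate]
      torsion[of "e 2" "e 3" "e 4" "e 5" "e 6", unfolded evaluate]
    by algebra+
  have solution7:
    "c 0 0 7 = - \<theta> (e 7) / 16"
    "c 1 0 6 = - \<theta> (e 7) / 16"
    "c 2 0 5 = \<theta> (e 7) / 16"
    "c 3 0 4 = - \<theta> (e 7) / 16"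
    "c 4 0 3 = \<theta> (e 7) / 16"
    "c 5 0 2 = - \<theta> (e 7) / 16"
    "c 6 0 1 = \<theta> (e 7) / 16"
    using
      torsion[of "e 0" "e 1" "e 2" "e 3" "e 7", unfolded evaluate]
      torsion[of "e 0" "e 1" "e 4" "e 5" "e 7", unfolded evaluate]
      torsion[of "e 0" "e 2" "e 4" "e 6" "e 7", unfolded evaluate]
      torsion[of "e 0" "e 3" "e 5" "e 6" "e 7", unfolded evaluate]
      torsion[of "e 1" "e 2" "e 5" "e 6" "e 7", unfolded evaluate]
      torsion[of "e 1" "e 3" "e 4" "e 6" "e 7", unfolded evaluate]
      torsion[of "e 2" "e 3" "e 4" "e 5" "e 7", unfolded evaluate]
    by algebra+
  note solutions = solution0 solution1 solution2 solution3 solution4 solution5 solution6 solution7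
  have t: "G [e i, t] = \<theta> (e i)" for i
    by (simp add: t_def linear_sum[OF linear_G2] linear_cmul[OF linear_G2] G_basis if_distrib cong: if_cong)
  \<comment> \<open>The values just found are compared with the claimed formula on all 512 triples
    of basis vectors; multilinearity then extends the formula to arbitrary vectors.\<close>
  have "\<forall>a b m. G [e m, C (e a) (e b)] = (\<theta> (e b) * G [e a, e m] - \<theta> (e m) * G [e a, e b] + F [t, e a, e b, e m]) / 16"
    unfolding all_8 F_basis_triples_permuted G_orthogonal c_def[symmetric] diag swaps relations solutions t F_repeated F_repeated'
    by simp
  then have basis: "G [C (e a) (e b), e m] =
    (\<theta> (e b) * G [e a, e m] - \<theta> (e m) * G [e a, e b] + F [t, e a, e b, e m]) / 16" for a b m
    by (simp only: G_sym[of _ "e m"])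
  note lin = linear_add[OF linear_F2] linear_add[OF linear_F3] linear_add[OF linear_F4]
    linear_add[OF linear_G1] linear_add[OF linear_G2] linear_add[OF C1] linear_add[OF C2] linear_add[OF \<theta>]
    linear_cmul[OF linear_F2] linear_cmul[OF linear_F3] linear_cmul[OF linear_F4]
    linear_cmul[OF linear_G1] linear_cmul[OF linear_G2] linear_cmul[OF C1] linear_cmul[OF C2] linear_cmul[OF \<theta>]
  define R where "R u v w = (\<theta> v * G [u, w] - \<theta> w * G [u, v] + F [t, u, v, w]) / 16" for u v w
  have R: "linear (\<lambda>u. R u v w)" "linear (\<lambda>v. R u v w)" "linear (R u v)" for u v w
    by (simp_all add: R_def linear_iff lin algebra_simps add_divide_distrib diff_divide_distrib)
  have L: "linear (\<lambda>u. G [C u v, w])" "linear (\<lambda>v. G [C u v, w])" "linear (\<lambda>w. G [C u v, w])" for u v w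
    by (simp_all add: linear_iff lin)
  have "G [C (e a) (e b), w] = R (e a) (e b) w" for a b w
    by (rule linear_eq_on_basis[OF L(3) R(3)]) (simp add: basis R_def)
  then have "G [C (e a) v, w] = R (e a) v w" for a v w
    by (rule linear_eq_on_basis[OF L(2) R(2)])
  then have "G [C u v, w] = R u v w"
    by (rule linear_eq_on_basis[OF L(1) R(1)])
  then show ?thesis by (simp add: R_def t_def)
qed

text \<open>This is the inclusion of \<open>\<Lambda>\<^sup>2\<^sub>2\<^sub>1\<close> in the Lie
  algebra of the stabilizer. On basis vectors with distinct indices i, j, k, l the sum involves the
  components of \<open>B\<close> at pairs with index sum i + j + k + l. If this sum is 0, these are
  diagonal entries and vanish; otherwise the four pairs make up one block, and the sum vanishes by
  the relation of that block.\<close>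

lemma spin7_invariant:
  assumes B: "linear B" and alternating: "alternating_form 2 (form_of_endo G B)"
    and star: "\<And>x y. hodge_basis G e 6 (wedge 4 F (form_of_endo G B)) [x, y] = - form_of_endo G B [x, y]"
  shows "F [B a, b, c, d] + F [a, B b, c, d] + F [a, b, B c, d] + F [a, b, c, B d] = 0"
proof -
  \<comment> \<open>With the image under \<open>B\<close> in the first slot, each term has the shape
    of \<open>F_basis_triples\<close>.\<close>
  define Q where "Q a b c d = F [B a, b, c, d] - F [B b, a, c, d] + F [B c, a, b, d] - F [B d, a, b, c]" for a b c d
  have Q: "F [B a, b, c, d] + F [a, B b, c, d] + F [a, b, B c, d] + F [a, b, c, B d] = Q a b c d" for a b c d
    using F_swap(1)[of "B b" a c d] F_swap(1)[of a "B c" b d] F_swap(2)[of a b "B c" d] F_rotate[of "B d" a b c]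
    unfolding Q_def by linarith
  define f where "f b m = G [e m, B (e b)]" for b m
  have f: "form_of_endo G B [e b, e m] = f b m" for b m
    by (simp add: form_of_endo_def f_def G_sym)
  have swap: "f m b = - f b m" and diag: "f b b = 0" for b m
    unfolding f[symmetric] using alternating by (rule alternating_2_swap)+
  note swaps =
    swap[of 1 0]
    swap[of 2 0]
    swap[of 3 0]
    swap[of 4 0]
    swap[of 5 0]
    swap[of 6 0]
    swap[of 7 0]
    swap[of 2 1]
    swap[of 3 1]
    swap[of 4 1]
    swap[of 5 1]
    swap[of 6 1]
    swap[of 7 1]
    swap[of 3 2]
    swap[of 4 2]
    swap[of 5 2]
    swap[of 6 2]
    swap[of 7 2]
    swap[of 4 3]
    swap[of 5 3]
    swap[of 6 3]
    swap[of 7 3]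
    swap[of 5 4]
    swap[of 6 4]
    swap[of 7 4]
    swap[of 6 5]
    swap[of 7 5]
    swap[of 7 6]
  note relations = Lambda2_21_relations[OF star, unfolded f]
  have Q_swap: "Q b a c d = - Q a b c d" "Q a c b d = - Q a b c d" "Q a b d c = - Q a b c d" "Q a a c d = 0" for a b c d
    unfolding Q_def by (simp_all add: F_swap(2)[of _ b a] F_swap(2)[of _ c b] F_swap(3)[of _ _ c b] F_swap(3)[of _ _ d c] F_repeated)
  have "\<forall>i j k l. i < j \<longrightarrow> j < k \<longrightarrow> k < l \<longrightarrow> Q (e i) (e j) (e k) (e l) = 0"
    by (simp add: all_8 less_8_evaluate Q_def F_basis_triples_permuted f_def[symmetric] swaps relations diag)
  then have basis: "Q (e i) (e j) (e k) (e l) = 0" for i j k l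
  proof (intro sorted_quadruples[of "\<lambda>i j k l. Q (e i) (e j) (e k) (e l) = 0" i j k l])
    fix i j k l assume "Q (e i) (e j) (e k) (e l) = 0"
    then show "Q (e j) (e i) (e k) (e l) = 0" "Q (e i) (e k) (e j) (e l) = 0" "Q (e i) (e j) (e l) (e k) = 0"
      using Q_swap(1)[of "e j" "e i"] Q_swap(2)[of "e i" "e k" "e j"] Q_swap(3)[of "e i" "e j" "e l" "e k"]
      by simp_all
  qed (simp_all add: Q_swap(4))
  note lin = linear_add[OF linear_F1] linear_add[OF linear_F2] linear_add[OF linear_F3] linear_add[OF linear_F4] linear_add[OF B]
    linear_cmul[OF linear_F1] linear_cmul[OF linear_F2] linear_cmul[OF linear_F3] linear_cmul[OF linear_F4] linear_cmul[OF B]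
  have L: "linear (\<lambda>a. Q a b c d)" "linear (\<lambda>b. Q a b c d)" "linear (\<lambda>c. Q a b c d)" "linear (Q a b c)" for a b c d
    by (simp_all add: Q_def linear_iff lin algebra_simps)
  have "Q (e i) (e j) (e k) d = 0" for i j k d
    by (rule linear_eq_on_basis[OF L(4) linear_zero basis])
  then have "Q (e i) (e j) c d = 0" for i j c d
    by (rule linear_eq_on_basis[OF L(3) linear_zero])
  then have "Q (e i) b c d = 0" for i b c d
    by (rule linear_eq_on_basis[OF L(2) linear_zero])
  then have "Q a b c d = 0"
    by (rule linear_eq_on_basis[OF L(1) linear_zero])
  then show ?thesis unfolding Q .
qed

text \<open>The definition of the minimal connection supplies its endomorphisms as bare functions.
  Their linearity is recovered from that of the associated 2-form, because \<open>G\<close> is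
  nondegenerate.\<close>

lemma linear_endo:
  assumes "alternating_form 2 (form_of_endo G B)"
  shows "linear B"
proof -
  have "linear (\<lambda>v. form_of_endo G B ([u, w][i := v]))" if "i < 2" for u w i
    using assms that unfolding alternating_form_def multilinear_form_def
    by (metis length_Cons list.size(3) numeral_2_eq_2)
  from this[of 0] have lin: "linear (\<lambda>v. G [w, B v])" for w
    by (simp add: form_of_endo_def G_sym[of w])
  show ?thesis
    unfolding linear_iff
  proof (intro conjI allI)
    show "B (u + v) = B u + B v" for u v
      by (rule G_nondegenerate) (simp add: linear_add[OF lin] linear_add[OF linear_G2])
    show "B (r *\<^sub>R v) = r *\<^sub>R B v" for r v
      by (rule G_nondegenerate) (simp add: linear_cmul[OF lin] linear_cmul[OF linear_G2])
  qed
qed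

text \<open>The first term of the formula contributes \<open>t\<close> once, the second contributes
  it eight times with a minus sign, and the 4-form vanishes on repeated arguments. \<open>C\<close>
  and \<open>t\<close> are arbitrary because the lemma serves twice: for the contorsion itself and
  for its covariant derivative.\<close>

lemma contorsion_trace:
  assumes "\<And>u v w. G [C u v, w] = (G [t, v] * G [u, w] - G [t, w] * G [u, v] + F [t, u, v, w]) / 16"
  shows "(\<Sum>i\<in>UNIV. C (e i) (e i)) = - (7/16) *\<^sub>R t"
proof (rule G_nondegenerate)
  fix k
  have "G [e k, \<Sum>i\<in>UNIV. C (e i) (e i)] = (\<Sum>i\<in>UNIV. G [C (e i) (e i), e k])"
    by (simp add: linear_sum[OF linear_G2] G_sym)
  also have "\<dots> = (\<Sum>i\<in>UNIV. (if i = k then G [t, e k] / 16 else 0) - G [t, e k] / 16)"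
    by (rule sum.cong[OF refl]) (simp add: assms G_basis F_repeated)
  also have "\<dots> = G [e k, - (7/16) *\<^sub>R t]"
    by (simp add: sum_subtractf linear_cmul[OF linear_G2] linear_neg[OF linear_G2] G_sym[of t])
  finally show "G [e k, \<Sum>i\<in>UNIV. C (e i) (e i)] = G [e k, - (7/16) *\<^sub>R t]" .
qed

lemma G_dual:
  assumes "linear \<theta>"
  shows "G [\<Sum>i\<in>UNIV. \<theta> (e i) *\<^sub>R e i, w] = \<theta> w"
proof -
  have "G [\<Sum>i\<in>UNIV. \<theta> (e i) *\<^sub>R e i, w] = (\<Sum>i\<in>UNIV. G [e i, w] * \<theta> (e i))"
    by (simp add: linear_sum[OF linear_G1] linear_cmul[OF linear_G1] mult.commute)
  also have "\<dots> = \<theta> (\<Sum>i\<in>UNIV. G [e i, w] *\<^sub>R e i)"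
    by (simp add: linear_sum[OF assms] linear_cmul[OF assms])
  also have "\<dots> = \<theta> w" by (simp only: expand[symmetric])
  finally show ?thesis .
qed

lemma quadrilinear_eq_zero:
  assumes L: "\<And>a b c d. linear (\<lambda>a. Q a b c d)" "\<And>a b c d. linear (\<lambda>b. Q a b c d)"
      "\<And>a b c d. linear (\<lambda>c. Q a b c d)" "\<And>a b c d. linear (Q a b c)"
    and basis: "\<And>i j k l. Q (e i) (e j) (e k) (e l) = (0 :: real)"
  shows "Q a b c d = 0"
proof -
  have "Q (e i) (e j) (e k) d = 0" for i j k d
    by (rule linear_eq_on_basis[OF L(4) linear_zero basis])
  then have "Q (e i) (e j) c d = 0" for i j c d
    by (rule linear_eq_on_basis[OF L(3) linear_zero])
  then have "Q (e i) b c d = 0" for i b c d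
    by (rule linear_eq_on_basis[OF L(2) linear_zero])
  then show ?thesis
    by (rule linear_eq_on_basis[OF L(1) linear_zero])
qed

end


section \<open>Differentiation in a chart\<close>

lemma smooth_on_differentiable:
  assumes "smooth_on S f" "x \<in> S"
  shows "f differentiable (at x)"
  using assms unfolding smooth_on_def by (metis Ck_on.simps(2))

text \<open>A product rule that asks only for derivatives of \<open>L y v\<close> at fixed
  \<open>v\<close>. It suffices because the argument lies in a finite-dimensional space and can be
  expanded in \<open>Basis\<close>, which leaves a finite sum of products.\<close>

lemma has_derivative_linear_family:
  fixes L :: "'v::real_normed_vector \<Rightarrow> 'e::euclidean_space \<Rightarrow> 'w::real_normed_vector"
  assumes U: "open U" "x \<in> U" and L: "\<And>y. y \<in> U \<Longrightarrow> linear (L y)"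
    and L': "\<And>v. ((\<lambda>y. L y v) has_derivative L' v) (at x)"
    and Y: "(Y has_derivative Y') (at x)"
  shows "((\<lambda>y. L y (Y y)) has_derivative (\<lambda>h. L' (Y x) h + L x (Y' h))) (at x)"
proof -
  have rep: "L y v = (\<Sum>b\<in>Basis. (v \<bullet> b) *\<^sub>R L y b)" if "y \<in> U" for y v
    using linear_sum[OF L[OF that], of "\<lambda>b. (v \<bullet> b) *\<^sub>R b" Basis]
    by (simp add: linear_cmul[OF L[OF that]] euclidean_representation)
  have "((\<lambda>y. \<Sum>b\<in>Basis. (v \<bullet> b) *\<^sub>R L y b) has_derivative (\<lambda>h. \<Sum>b\<in>Basis. (v \<bullet> b) *\<^sub>R L' b h)) (at x)" for v
    by (intro has_derivative_sum has_derivative_scaleR_right L')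
  then have "((\<lambda>y. L y v) has_derivative (\<lambda>h. \<Sum>b\<in>Basis. (v \<bullet> b) *\<^sub>R L' b h)) (at x)" for v
    by (rule has_derivative_transform_within_open[OF _ U]) (simp add: rep)
  \<comment> \<open>The derivatives \<open>L' v\<close> are given separately for each
    \<open>v\<close>; uniqueness of derivatives shows that they depend on \<open>v\<close> through
    its coordinates.\<close>
  then have L'_rep: "L' v = (\<lambda>h. \<Sum>b\<in>Basis. (v \<bullet> b) *\<^sub>R L' b h)" for v
    using L' has_derivative_unique by blast
  have "((\<lambda>y. \<Sum>b\<in>Basis. (Y y \<bullet> b) *\<^sub>R L y b) has_derivative
      (\<lambda>h. \<Sum>b\<in>Basis. (Y x \<bullet> b) *\<^sub>R L' b h + (Y' h \<bullet> b) *\<^sub>R L x b)) (at x)"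
    by (intro has_derivative_sum has_derivative_scaleR L' has_derivative_inner_left Y)
  then have "((\<lambda>y. L y (Y y)) has_derivative
      (\<lambda>h. \<Sum>b\<in>Basis. (Y x \<bullet> b) *\<^sub>R L' b h + (Y' h \<bullet> b) *\<^sub>R L x b)) (at x)"
    by (rule has_derivative_transform_within_open[OF _ U]) (simp add: rep)
  moreover have "(\<Sum>b\<in>Basis. (Y x \<bullet> b) *\<^sub>R L' b h + (Y' h \<bullet> b) *\<^sub>R L x b) = L' (Y x) h + L x (Y' h)" for h
    using L'_rep[of "Y x"] rep[OF U(2), of "Y' h"] by (simp add: sum.distrib)
  ultimately show ?thesis by simp
qed

lemma linear_derivative_family:
  fixes L :: "'v::real_normed_vector \<Rightarrow> 'e::real_vector \<Rightarrow> 'w::real_normed_vector"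
  assumes U: "open U" "x \<in> U" and L: "\<And>y. y \<in> U \<Longrightarrow> linear (L y)"
    and L': "\<And>v. ((\<lambda>y. L y v) has_derivative L' v) (at x)"
  shows "linear (\<lambda>v. L' v h)"
proof -
  have "((\<lambda>y. L y (v + w)) has_derivative (\<lambda>h. L' v h + L' w h)) (at x)" for v w
    by (rule has_derivative_transform_within_open[OF has_derivative_add[OF L'[of v] L'[of w]] U])
       (simp add: linear_add[OF L])
  then have "L' (v + w) = (\<lambda>h. L' v h + L' w h)" for v w
    using L' has_derivative_unique by blast
  moreover have "((\<lambda>y. L y (r *\<^sub>R v)) has_derivative (\<lambda>h. r *\<^sub>R L' v h)) (at x)" for r v
    by (rule has_derivative_transform_within_open[OF has_derivative_scaleR_right[OF L'[of v]] U])
       (simp add: linear_cmul[OF L])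
  then have "L' (r *\<^sub>R v) = (\<lambda>h. r *\<^sub>R L' v h)" for r v
    using L' has_derivative_unique by blast
  ultimately show ?thesis by (simp add: linear_iff)
qed

text \<open>The coordinate expressions in a single chart: \<open>N\<close> is the Levi-Civita
  connection, \<open>D\<close> the minimal one, \<open>F\<close> the 4-form. Both sides of the
  theorem are conditions at the points of each chart separately, so one chart at a time can be
  treated.\<close>

locale spin7_chart =
  fixes U :: "(real^8) set" and G F \<theta> :: "real^8 \<Rightarrow> (real^8) list \<Rightarrow> real"
    and N D :: "real^8 \<Rightarrow> real^8 \<Rightarrow> real^8 \<Rightarrow> real^8"
  assumes open_U: "open U"
    and G_form: "\<And>x. x \<in> U \<Longrightarrow> multilinear_form 2 (G x)" "\<And>x u v. x \<in> U \<Longrightarrow> G x [u, v] = G x [v, u]"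
    and F_form: "\<And>x. x \<in> U \<Longrightarrow> alternating_form 4 (F x)"
    and differentiable: "\<And>x a b. x \<in> U \<Longrightarrow> (\<lambda>y. G y [a, b]) differentiable (at x)"
      "\<And>x a b c d. x \<in> U \<Longrightarrow> (\<lambda>y. F y [a, b, c, d]) differentiable (at x)"
      "\<And>x u v. x \<in> U \<Longrightarrow> (\<lambda>y. N y u v) differentiable (at x)"
      "\<And>x u v. x \<in> U \<Longrightarrow> (\<lambda>y. D y u v) differentiable (at x)"
    and bilinear: "\<And>x. x \<in> U \<Longrightarrow> bilinear (N x)" "\<And>x. x \<in> U \<Longrightarrow> bilinear (D x)"
    and N_sym: "\<And>x u v. x \<in> U \<Longrightarrow> N x u v = N x v u"
    and frame: "\<And>x. x \<in> U \<Longrightarrow> \<exists>W e. x \<in> W \<and> W \<subseteq> U \<and> adapted_frame_on W G F e"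
    and minimal: "\<And>W e x u. W \<subseteq> U \<Longrightarrow> adapted_frame_on W G F e \<Longrightarrow> x \<in> W \<Longrightarrow>
      \<exists>B C. form_of_endo (G x) B \<in> Lambda2_21 (G x) (F x) \<and> form_of_endo (G x) C \<in> Lambda2_7 (G x) (F x) \<and>
        (\<forall>j. cov_deriv_vector N (\<lambda>y. e y j) x u = B (e x j) + C (e x j)) \<and>
        (\<forall>j. cov_deriv_vector D (\<lambda>y. e y j) x u = B (e x j))"
    and linear_\<theta>: "\<And>x. x \<in> U \<Longrightarrow> linear (\<lambda>v. \<theta> x [v])"
    and conformal: "\<And>x vs. x \<in> U \<Longrightarrow> length vs = 5 \<Longrightarrow> ext_deriv F x vs = wedge 1 (\<theta> x) (F x) vs"
begin

definition C :: "real^8 \<Rightarrow> real^8 \<Rightarrow> real^8 \<Rightarrow> real^8" where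
  "C x u v = N x u v - D x u v"

text \<open>The very choice made in \<open>hodge\<close>, so that the star in
  \<open>Lambda2_7\<close> and \<open>Lambda2_21\<close> is the star of this basis. It need not vary
  continuously with \<open>x\<close>; derivatives are taken in the frames provided by
  \<open>frame\<close>.\<close>

definition basis_at :: "real^8 \<Rightarrow> 8 \<Rightarrow> real^8" where
  "basis_at x = (SOME e. adapted_basis (G x) (F x) e)"

lemma adaptedI: "x \<in> U \<Longrightarrow> adapted_basis (G x) (F x) e \<Longrightarrow> adapted (G x) (F x) e"
  by (rule adapted.intro[OF G_form F_form])

lemma adapted_at:
  assumes "x \<in> U"
  shows "adapted (G x) (F x) (basis_at x)"
proof -
  obtain W e where "x \<in> W" "adapted_frame_on W G F e" using frame[OF assms] by blast
  then have "adapted_basis (G x) (F x) (e x)" by (simp add: adapted_frame_on_def)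
  then show ?thesis unfolding basis_at_def by (intro adaptedI[OF assms] someI[of "adapted_basis (G x) (F x)" "e x"])
qed

lemma bilinear_C: "x \<in> U \<Longrightarrow> bilinear (C x)"
  using bilinear[of x] unfolding C_def bilinear_def by (simp add: linear_compose_sub)

lemma frameE:
  assumes "x \<in> U"
  obtains W e where "open W" "x \<in> W" "W \<subseteq> U" "adapted_frame_on W G F e"
    "\<And>y. y \<in> W \<Longrightarrow> adapted (G y) (F y) (e y)" "\<And>i. (\<lambda>y. e y i) differentiable (at x)"
proof -
  obtain W e where W: "x \<in> W" "W \<subseteq> U" "adapted_frame_on W G F e" using frame[OF assms] by blast
  have "open W" and smooth: "\<And>i. smooth_on W (\<lambda>y. e y i)"
    and basis: "\<And>y. y \<in> W \<Longrightarrow> adapted_basis (G y) (F y) (e y)"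
    using W(3) by (simp_all add: adapted_frame_on_def)
  from \<open>open W\<close> W show ?thesis
  proof (rule that)
    show "adapted (G y) (F y) (e y)" if "y \<in> W" for y
      using adaptedI[OF subsetD[OF W(2) that] basis[OF that]] .
    show "(\<lambda>y. e y i) differentiable (at x)" for i
      using smooth_on_differentiable[OF smooth W(1)] .
  qed
qed

text \<open>Subtracting the two connection forms cancels the derivatives of the frame, so the
  \<open>\<Lambda>\<^sup>2\<^sub>7\<close>-part agrees with \<open>C x u\<close> on the frame, hence
  everywhere by linearity. The other part \<open>B\<close> is the connection form of
  \<open>D\<close> and controls the derivatives of the frame.\<close>

lemma connection_form:
  assumes x: "x \<in> W" and W: "W \<subseteq> U" "adapted_frame_on W G F e"
  shows "\<exists>B. form_of_endo (G x) B \<in> Lambda2_21 (G x) (F x) \<and> form_of_endo (G x) (C x u) \<in> Lambda2_7 (G x) (F x) \<and>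
    (\<forall>j. frechet_derivative (\<lambda>y. e y j) (at x) u = B (e x j) - D x u (e x j))"
proof -
  interpret adapted "G x" "F x" "e x"
    using adaptedI x W by (auto simp: adapted_frame_on_def)
  obtain B C' where BC: "form_of_endo (G x) B \<in> Lambda2_21 (G x) (F x)"
    "form_of_endo (G x) C' \<in> Lambda2_7 (G x) (F x)"
    "\<And>j. cov_deriv_vector N (\<lambda>y. e y j) x u = B (e x j) + C' (e x j)"
    "\<And>j. cov_deriv_vector D (\<lambda>y. e y j) x u = B (e x j)"
    using minimal[OF W x] by blast
  have "linear C'" using BC(2) linear_endo by (auto simp: Lambda2_7_def)
  moreover have "linear (C x u)" using bilinear_C[of x] x W by (auto simp: bilinear_def)
  moreover have "C' (e x j) = C x u (e x j)" for j
  proof -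
    have "C' (e x j) = cov_deriv_vector N (\<lambda>y. e y j) x u - cov_deriv_vector D (\<lambda>y. e y j) x u"
      using BC(3,4)[of j] by simp
    then show ?thesis by (simp add: C_def cov_deriv_vector_def)
  qed
  ultimately have "C' v = C x u v" for v by (rule linear_eq_on_basis)
  then have "C' = C x u" by (rule ext)
  moreover have "frechet_derivative (\<lambda>y. e y j) (at x) u = B (e x j) - D x u (e x j)" for j
    using BC(4)[of j] by (simp add: cov_deriv_vector_def eq_diff_eq)
  ultimately show ?thesis using BC(1,2) by blast
qed

section \<open>Parallelism of the metric and of the 4-form for the minimal connection\<close>

definition dG :: "real^8 \<Rightarrow> real^8 \<Rightarrow> real^8 \<Rightarrow> real^8 \<Rightarrow> real" where
  "dG x a b = frechet_derivative (\<lambda>y. G y [a, b]) (at x)"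

definition dF :: "real^8 \<Rightarrow> real^8 \<Rightarrow> real^8 \<Rightarrow> real^8 \<Rightarrow> real^8 \<Rightarrow> real^8 \<Rightarrow> real" where
  "dF x a b c d = frechet_derivative (\<lambda>y. F y [a, b, c, d]) (at x)"

lemma has_dG: "x \<in> U \<Longrightarrow> ((\<lambda>y. G y [a, b]) has_derivative dG x a b) (at x)"
  and has_dF: "x \<in> U \<Longrightarrow> ((\<lambda>y. F y [a, b, c, d]) has_derivative dF x a b c d) (at x)"
  using differentiable(1,2) by (simp_all add: dG_def dF_def frechet_derivative_works)

lemmas linear_G = adapted.linear_G1[OF adapted_at] adapted.linear_G2[OF adapted_at]
lemmas linear_F = adapted.linear_F1[OF adapted_at] adapted.linear_F2[OF adapted_at]
  adapted.linear_F3[OF adapted_at] adapted.linear_F4[OF adapted_at]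

lemma G_Leibniz:
  assumes x: "x \<in> U" and a: "(a has_derivative a') (at x)" and b: "(b has_derivative b') (at x)"
  shows "((\<lambda>y. G y [a y, b y]) has_derivative
    (\<lambda>h. dG x (a x) (b x) h + G x [a' h, b x] + G x [a x, b' h])) (at x)"
proof -
  note family = has_derivative_linear_family[OF open_U x]
  have partial: "((\<lambda>y. G y [a y, b]) has_derivative (\<lambda>h. dG x (a x) b h + G x [a' h, b])) (at x)" for b
    by (rule family[of "\<lambda>y v. G y [v, b]" "\<lambda>v. dG x v b" a a']) (erule linear_G(1), rule has_dG[OF x], rule a)
  show ?thesis
    by (rule family[of "\<lambda>y v. G y [a y, v]" "\<lambda>v h. dG x (a x) v h + G x [a' h, v]" b b']) (erule linear_G(2), rule partial, rule b)
qed

lemma F_Leibniz: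
  assumes x: "x \<in> U" and a: "(a has_derivative a') (at x)" and b: "(b has_derivative b') (at x)"
    and c: "(c has_derivative c') (at x)" and d: "(d has_derivative d') (at x)"
  shows "((\<lambda>y. F y [a y, b y, c y, d y]) has_derivative
    (\<lambda>h. dF x (a x) (b x) (c x) (d x) h + F x [a' h, b x, c x, d x] + F x [a x, b' h, c x, d x]
      + F x [a x, b x, c' h, d x] + F x [a x, b x, c x, d' h])) (at x)"
proof -
  note family = has_derivative_linear_family[OF open_U x]
  have partial1: "((\<lambda>y. F y [a y, b, c, d]) has_derivative (\<lambda>h. dF x (a x) b c d h + F x [a' h, b, c, d])) (at x)" for b c d
    by (rule family[of "\<lambda>y v. F y [v, b, c, d]" "\<lambda>v. dF x v b c d" a a']) (erule linear_F(1), rule has_dF[OF x], rule a)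
  have partial2: "((\<lambda>y. F y [a y, b y, c, d]) has_derivative
      (\<lambda>h. dF x (a x) (b x) c d h + F x [a' h, b x, c, d] + F x [a x, b' h, c, d])) (at x)" for c d
    by (rule family[of "\<lambda>y v. F y [a y, v, c, d]" "\<lambda>v h. dF x (a x) v c d h + F x [a' h, v, c, d]" b b']) (erule linear_F(2), rule partial1, rule b)
  have partial3: "((\<lambda>y. F y [a y, b y, c y, d]) has_derivative
      (\<lambda>h. dF x (a x) (b x) (c x) d h + F x [a' h, b x, c x, d] + F x [a x, b' h, c x, d] + F x [a x, b x, c' h, d])) (at x)" for d
    by (rule family[of "\<lambda>y v. F y [a y, b y, v, d]"
      "\<lambda>v h. dF x (a x) (b x) v d h + F x [a' h, b x, v, d] + F x [a x, b' h, v, d]" c c']) (erule linear_F(3), rule partial2, rule c)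
  show ?thesis
    by (rule family[of "\<lambda>y v. F y [a y, b y, c y, v]"
      "\<lambda>v h. dF x (a x) (b x) (c x) v h + F x [a' h, b x, c x, v] + F x [a x, b' h, c x, v] + F x [a x, b x, c' h, v]" d d']) (erule linear_F(4), rule partial3, rule d)
qed

lemma frame_has_derivative:
  assumes "\<And>i. (\<lambda>y. e y i) differentiable (at x)"
  shows "((\<lambda>y. e y i) has_derivative frechet_derivative (\<lambda>y. e y i) (at x)) (at x)"
  using assms by (simp add: frechet_derivative_works)

lemma has_derivative_locally_constant:
  assumes f: "(f has_derivative f') (at x)" and W: "open W" "x \<in> W" and const: "\<And>y. y \<in> W \<Longrightarrow> f y = k"
  shows "f' h = 0"
proof -
  have "(f has_derivative (\<lambda>_. 0)) (at x)"
    by (rule has_derivative_transform_within_open[OF has_derivative_const W]) (simp add: const)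
  then show ?thesis using has_derivative_unique[OF f] by simp
qed

text \<open>In an adapted frame the metric has constant coefficients, and the connection form
  \<open>B\<close> of \<open>D\<close> is skew. Differentiating the orthonormality relations gives
  the claim on frame vectors.\<close>

lemma G_parallel:
  assumes x: "x \<in> U"
  shows "dG x a b u = G x [D x u a, b] + G x [a, D x u b]"
proof -
  obtain W e where W: "open W" "x \<in> W" "W \<subseteq> U" "adapted_frame_on W G F e"
    and ad: "\<And>y. y \<in> W \<Longrightarrow> adapted (G y) (F y) (e y)" and e: "\<And>i. (\<lambda>y. e y i) differentiable (at x)"
    by (rule frameE[OF x]) (rule that)
  interpret adapted "G x" "F x" "e x" using ad W by blast
  obtain B where B: "form_of_endo (G x) B \<in> Lambda2_21 (G x) (F x)"
    and de: "\<And>j. frechet_derivative (\<lambda>y. e y j) (at x) u = B (e x j) - D x u (e x j)"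
    using connection_form[OF W(2-4), of u] by blast
  have skew: "G x [B v, w] + G x [v, B w] = 0" for v w
    using alternating_2_swap(1)[of "form_of_endo (G x) B" w v] B
    by (simp add: Lambda2_21_def form_of_endo_def G_sym[of v])
  have L: "linear (\<lambda>a. dG x a b u)" "linear (\<lambda>b. dG x a b u)" for a b
    using linear_derivative_family[OF open_U x, of "\<lambda>y v. G y [v, b]" "\<lambda>v. dG x v b"]
      linear_derivative_family[OF open_U x, of "\<lambda>y v. G y [a, v]" "\<lambda>v. dG x a v"]
      linear_G has_dG[OF x] by auto
  have D: "linear (D x u)" using bilinear(2)[OF x] by (simp add: bilinear_def)
  note lin = linear_add[OF L(1)] linear_add[OF L(2)] linear_add[OF D] linear_add[OF linear_G1] linear_add[OF linear_G2]
    linear_cmul[OF L(1)] linear_cmul[OF L(2)] linear_cmul[OF D] linear_cmul[OF linear_G1] linear_cmul[OF linear_G2]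
  define P where "P a b = dG x a b u - (G x [D x u a, b] + G x [a, D x u b])" for a b
  have P: "linear (\<lambda>a. P a b)" "linear (P a)" for a b
    by (simp_all add: P_def linear_iff lin algebra_simps)
  have "P (e x i) (e x j) = 0" for i j
  proof -
    have "dG x (e x i) (e x j) u + G x [frechet_derivative (\<lambda>y. e y i) (at x) u, e x j]
        + G x [e x i, frechet_derivative (\<lambda>y. e y j) (at x) u] = 0"
      by (rule has_derivative_locally_constant[OF G_Leibniz[OF x frame_has_derivative[OF e] frame_has_derivative[OF e]] W(1,2)])
         (rule adapted.G_basis[OF ad])
    then show ?thesis using skew[of "e x i" "e x j"]
      by (simp add: P_def de linear_diff[OF linear_G1] linear_diff[OF linear_G2])
  qed
  then have "P (e x i) b = 0" for i b
    by (rule linear_eq_on_basis[OF P(2) linear_zero])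
  then have "P a b = 0"
    by (rule linear_eq_on_basis[OF P(1) linear_zero])
  then show ?thesis by (simp add: P_def)
qed

lemma hodge_at: "hodge (G x) (F x) = hodge_basis (G x) (basis_at x)"
  by (simp add: hodge_def basis_at_def)

text \<open>The 4-form has constant coefficients in an adapted frame, and the connection form
  \<open>B\<close> annihilates it.\<close>

lemma F_parallel:
  assumes x: "x \<in> U"
  shows "dF x a b c d u = F x [D x u a, b, c, d] + F x [a, D x u b, c, d] + F x [a, b, D x u c, d] + F x [a, b, c, D x u d]"
proof -
  obtain W e where W: "open W" "x \<in> W" "W \<subseteq> U" "adapted_frame_on W G F e"
    and ad: "\<And>y. y \<in> W \<Longrightarrow> adapted (G y) (F y) (e y)" and e: "\<And>i. (\<lambda>y. e y i) differentiable (at x)"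
    by (rule frameE[OF x]) (rule that)
  interpret adapted "G x" "F x" "e x" using ad W by blast
  obtain B where B: "form_of_endo (G x) B \<in> Lambda2_21 (G x) (F x)"
    and de: "\<And>j. frechet_derivative (\<lambda>y. e y j) (at x) u = B (e x j) - D x u (e x j)"
    using connection_form[OF W(2-4), of u] by blast
  \<comment> \<open>Membership in \<open>Lambda2_21\<close> refers to the star of the chosen basis,
    so the invariance is taken from \<open>basis_at x\<close> and not from the frame
    \<open>e x\<close>; its conclusion mentions no basis.\<close>
  have invariant: "F x [B a, b, c, d] + F x [a, B b, c, d] + F x [a, b, B c, d] + F x [a, b, c, B d] = 0" for a b c d
    by (rule adapted.spin7_invariant[OF adapted_at[OF x]])
       (use B linear_endo in \<open>auto simp: Lambda2_21_def hodge_at\<close>)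
  have L: "linear (\<lambda>a. dF x a b c d u)" "linear (\<lambda>b. dF x a b c d u)" "linear (\<lambda>c. dF x a b c d u)"
      "linear (\<lambda>d. dF x a b c d u)" for a b c d
    using linear_derivative_family[OF open_U x, of "\<lambda>y v. F y [v, b, c, d]" "\<lambda>v. dF x v b c d"]
      linear_derivative_family[OF open_U x, of "\<lambda>y v. F y [a, v, c, d]" "\<lambda>v. dF x a v c d"]
      linear_derivative_family[OF open_U x, of "\<lambda>y v. F y [a, b, v, d]" "\<lambda>v. dF x a b v d"]
      linear_derivative_family[OF open_U x, of "\<lambda>y v. F y [a, b, c, v]" "\<lambda>v. dF x a b c v"]
      linear_F has_dF[OF x] by auto
  have D: "linear (D x u)" using bilinear(2)[OF x] by (simp add: bilinear_def)
  note lin = linear_add[OF L(1)] linear_add[OF L(2)] linear_add[OF L(3)] linear_add[OF L(4)] linear_add[OF D]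
    linear_add[OF linear_F1] linear_add[OF linear_F2] linear_add[OF linear_F3] linear_add[OF linear_F4]
    linear_cmul[OF L(1)] linear_cmul[OF L(2)] linear_cmul[OF L(3)] linear_cmul[OF L(4)] linear_cmul[OF D]
    linear_cmul[OF linear_F1] linear_cmul[OF linear_F2] linear_cmul[OF linear_F3] linear_cmul[OF linear_F4]
  define P where "P a b c d = dF x a b c d u -
    (F x [D x u a, b, c, d] + F x [a, D x u b, c, d] + F x [a, b, D x u c, d] + F x [a, b, c, D x u d])" for a b c d
  have P: "linear (\<lambda>a. P a b c d)" "linear (\<lambda>b. P a b c d)" "linear (\<lambda>c. P a b c d)" "linear (P a b c)" for a b c d
    by (simp_all add: P_def linear_iff lin algebra_simps)
  have "P (e x i) (e x j) (e x k) (e x l) = 0" for i j k l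
  proof -
    let ?de = "\<lambda>i. frechet_derivative (\<lambda>y. e y i) (at x) u"
    \<comment> \<open>The right-hand side uses the index type itself in place of vectors, with the
      Kronecker delta as coframe: a constant that does not involve \<open>y\<close>.\<close>
    have "F y [e y i, e y j, e y k, e y l] = spin7_form (\<lambda>i j. if i = j then 1 else 0) [i, j, k, l]" if "y \<in> W" for y
    proof -
      interpret y: adapted "G y" "F y" "e y" using ad that by blast
      have "(\<lambda>i. dual_basis (G y) (e y) i \<circ> e y) = (\<lambda>i j. if i = j then 1 else 0)"
        by (simp add: fun_eq_iff y.coframe_basis)
      then show ?thesis
        using y.F_coframe[of "map (e y) [i, j, k, l]"] spin7_form_map[of "dual_basis (G y) (e y)" "e y" "[i, j, k, l]"]
        by simp
    qed
    then have "dF x (e x i) (e x j) (e x k) (e x l) u + F x [?de i, e x j, e x k, e x l] + F x [e x i, ?de j, e x k, e x l]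
        + F x [e x i, e x j, ?de k, e x l] + F x [e x i, e x j, e x k, ?de l] = 0"
      by (rule has_derivative_locally_constant[OF F_Leibniz[OF x frame_has_derivative[OF e] frame_has_derivative[OF e]
            frame_has_derivative[OF e] frame_has_derivative[OF e]] W(1,2)])
    then show ?thesis using invariant[of "e x i" "e x j" "e x k" "e x l"]
      by (simp add: P_def de linear_diff[OF linear_F1] linear_diff[OF linear_F2] linear_diff[OF linear_F3] linear_diff[OF linear_F4])
  qed
  then have "P a b c d = 0" by (rule quadrilinear_eq_zero[OF P])
  then show ?thesis by (simp add: P_def)
qed

section \<open>The contorsion in a chart expressed by the Lee form\<close>

lemma Lambda2_7_C:
  assumes "x \<in> U"
  shows "form_of_endo (G x) (C x u) \<in> Lambda2_7 (G x) (F x)"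
proof -
  obtain W e where "x \<in> W" "W \<subseteq> U" "adapted_frame_on W G F e" using frame[OF assms] by blast
  from connection_form[OF this, of u] show ?thesis by blast
qed

lemma dF_first:
  assumes "x \<in> U"
  shows "dF x a b c d u = F x [D x u a, b, c, d] - F x [D x u b, a, c, d] + F x [D x u c, a, b, d] - F x [D x u d, a, b, c]"
proof -
  interpret adapted "G x" "F x" "basis_at x" by (rule adapted_at[OF assms])
  show ?thesis
    using F_parallel[OF assms, of a b c d u] F_swap(1)[of "D x u b" a c d] F_swap(1)[of a "D x u c" b d]
      F_swap(2)[of a b "D x u c" d] F_rotate[of "D x u d" a b c]
    by linarith
qed

text \<open>Parallelism of the 4-form turns the five partial derivatives in the exterior derivative
  into twenty terms without derivatives. They combine in pairs into ten terms with
  \<open>T\<close>.\<close>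

lemma torsion:
  assumes x: "x \<in> U"
  defines "T \<equiv> \<lambda>u v. C x u v - C x v u"
  shows "- F x [T a b, c, d, f] + F x [T a c, b, d, f] - F x [T a d, b, c, f] + F x [T a f, b, c, d]
      - F x [T b c, a, d, f] + F x [T b d, a, c, f] - F x [T b f, a, c, d]
      - F x [T c d, a, b, f] + F x [T c f, a, b, d] - F x [T d f, a, b, c] =
      \<theta> x [a] * F x [b, c, d, f] - \<theta> x [b] * F x [a, c, d, f] + \<theta> x [c] * F x [a, b, d, f]
      - \<theta> x [d] * F x [a, b, c, f] + \<theta> x [f] * F x [a, b, c, d]"
proof -
  \<comment> \<open>Symmetry of the Levi-Civita symbols leaves minus the torsion of
    \<open>D\<close>.\<close>
  have T: "T u v = D x v u - D x u v" for u v
    using N_sym[OF x, of u v] by (simp add: T_def C_def)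
  have "ext_deriv F x [a, b, c, d, f] =
      dF x b c d f a - dF x a c d f b + dF x a b d f c - dF x a b c f d + dF x a b c d f"
    by (simp add: ext_deriv_def dF_def eval_nat_numeral)
  moreover have "wedge 1 (\<theta> x) (F x) [a, b, c, d, f] =
      \<theta> x [a] * F x [b, c, d, f] - \<theta> x [b] * F x [a, c, d, f] + \<theta> x [c] * F x [a, b, d, f]
      - \<theta> x [d] * F x [a, b, c, f] + \<theta> x [f] * F x [a, b, c, d]"
    by (simp add: wedge_Cons wedge_0 wedge_Nil)
  moreover have "F x [T u v, a, b, c] = F x [D x v u, a, b, c] - F x [D x u v, a, b, c]" for u v a b c
    unfolding T by (rule linear_diff[OF linear_F(1)[OF x]])
  ultimately show ?thesis
    using conformal[OF x, of "[a, b, c, d, f]"] by (simp add: dF_first[OF x])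
qed

definition lee_vector :: "real^8 \<Rightarrow> real^8" where
  "lee_vector x = (\<Sum>i\<in>UNIV. \<theta> x [basis_at x i] *\<^sub>R basis_at x i)"

lemma G_lee_vector: "x \<in> U \<Longrightarrow> G x [lee_vector x, w] = \<theta> x [w]"
  unfolding lee_vector_def by (rule adapted.G_dual[OF adapted_at linear_\<theta>])

lemma C_formula:
  assumes x: "x \<in> U"
  shows "G x [C x u v, w] =
    (G x [lee_vector x, v] * G x [u, w] - G x [lee_vector x, w] * G x [u, v] + F x [lee_vector x, u, v, w]) / 16"
  unfolding G_lee_vector[OF x] unfolding lee_vector_def
proof (rule adapted.contorsion_formula[OF adapted_at[OF x] bilinear_C[OF x] linear_\<theta>[OF x]])
  show "alternating_form 2 (form_of_endo (G x) (C x u))" for u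
    using Lambda2_7_C[OF x] by (simp add: Lambda2_7_def)
  show "hodge_basis (G x) (basis_at x) 6 (wedge 4 (F x) (form_of_endo (G x) (C x u))) [y, z] =
      3 * form_of_endo (G x) (C x u) [y, z]" for u y z
    using Lambda2_7_C[OF x, of u] by (simp add: Lambda2_7_def hodge_at)
qed (rule torsion[OF x])

section \<open>Covariant derivatives of the contorsion and of the Lee vector\<close>

definition dC :: "real^8 \<Rightarrow> real^8 \<Rightarrow> real^8 \<Rightarrow> real^8 \<Rightarrow> real^8" where
  "dC x v w = frechet_derivative (\<lambda>y. C y v w) (at x)"

lemma has_dC: "x \<in> U \<Longrightarrow> ((\<lambda>y. C y v w) has_derivative dC x v w) (at x)"
  unfolding dC_def C_def frechet_derivative_works[symmetric]
  by (intro differentiable_diff differentiable)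

lemma C_Leibniz:
  assumes x: "x \<in> U" and a: "(a has_derivative a') (at x)" and b: "(b has_derivative b') (at x)"
  shows "((\<lambda>y. C y (a y) (b y)) has_derivative
    (\<lambda>h. dC x (a x) (b x) h + C x (a' h) (b x) + C x (a x) (b' h))) (at x)"
proof -
  note family = has_derivative_linear_family[OF open_U x]
  have lin: "linear (\<lambda>v. C y v w)" "linear (\<lambda>w. C y v w)" if "y \<in> U" for y v w
    using bilinear_C[OF that] by (simp_all add: bilinear_def)
  have partial: "((\<lambda>y. C y (a y) b) has_derivative (\<lambda>h. dC x (a x) b h + C x (a' h) b)) (at x)" for b
    by (rule family[of "\<lambda>y v. C y v b" "\<lambda>v. dC x v b" a a']) (erule lin(1), rule has_dC[OF x], rule a)
  show ?thesis
    by (rule family[of "\<lambda>y v. C y (a y) v" "\<lambda>v h. dC x (a x) v h + C x (a' h) v" b b'])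
       (erule lin(2), rule partial, rule b)
qed

text \<open>\<open>lee_vector\<close> is built from an arbitrary choice of bases; its differentiability comes from that of \<open>C\<close>
  via the trace formula in a smooth local frame.\<close>

lemma lee_vector_differentiable:
  assumes x: "x \<in> U"
  shows "lee_vector differentiable (at x)"
proof -
  obtain W e where W: "open W" "x \<in> W" "W \<subseteq> U"
    and ad: "\<And>y. y \<in> W \<Longrightarrow> adapted (G y) (F y) (e y)" and e: "\<And>i. (\<lambda>y. e y i) differentiable (at x)"
    by (rule frameE[OF x]) (rule that)
  have eq: "- (16/7) *\<^sub>R (\<Sum>i\<in>UNIV. C y (e y i) (e y i)) = lee_vector y" if "y \<in> W" for y
    using adapted.contorsion_trace[OF ad[OF that] C_formula] that W(3) by (simp add: subset_iff)
  note de = frame_has_derivative[OF e]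
  have "((\<lambda>y. - (16/7) *\<^sub>R (\<Sum>i\<in>UNIV. C y (e y i) (e y i))) has_derivative
     (\<lambda>h. - (16/7) *\<^sub>R (\<Sum>i\<in>UNIV. dC x (e x i) (e x i) h
        + C x (frechet_derivative (\<lambda>y. e y i) (at x) h) (e x i)
        + C x (e x i) (frechet_derivative (\<lambda>y. e y i) (at x) h)))) (at x)"
    by (rule has_derivative_scaleR_right[OF has_derivative_sum[OF C_Leibniz[OF x de de]]])
  then have "(lee_vector has_derivative
     (\<lambda>h. - (16/7) *\<^sub>R (\<Sum>i\<in>UNIV. dC x (e x i) (e x i) h
        + C x (frechet_derivative (\<lambda>y. e y i) (at x) h) (e x i)
        + C x (e x i) (frechet_derivative (\<lambda>y. e y i) (at x) h)))) (at x)"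
    by (rule has_derivative_transform_within_open[OF _ W(1,2) eq])
  then show ?thesis by (rule differentiableI)
qed

definition D_lee_vector :: "real^8 \<Rightarrow> real^8 \<Rightarrow> real^8" where
  "D_lee_vector x u = frechet_derivative lee_vector (at x) u + D x u (lee_vector x)"

definition D_C :: "real^8 \<Rightarrow> real^8 \<Rightarrow> real^8 \<Rightarrow> real^8 \<Rightarrow> real^8" where
  "D_C x u v w = dC x v w u + D x u (C x v w) - C x (D x u v) w - C x v (D x u w)"

lemma cov_deriv_torsion:
  assumes x: "x \<in> U"
  shows "cov_deriv_12 D (\<lambda>y u v. D y u v - N y u v) x u v w = - D_C x u v w"
proof -
  have "((\<lambda>y. D y v w - N y v w) has_derivative (\<lambda>h. - dC x v w h)) (at x)"
    using has_derivative_minus[OF has_dC[OF x, of v w]] by (simp add: C_def)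
  then have "frechet_derivative (\<lambda>y. D y v w - N y v w) (at x) = (\<lambda>h. - dC x v w h)"
    by (rule frechet_derivative_at[symmetric])
  moreover have "linear (D x u)" using bilinear(2)[OF x] by (simp add: bilinear_def)
  ultimately show ?thesis
    by (simp add: cov_deriv_12_def D_C_def C_def linear_diff)
qed

text \<open>The remaining arguments have constant coordinates, but their covariant derivatives are
  given by the Christoffel symbols; these are the terms with \<open>D x u\<close> applied to an
  argument.\<close>

lemma lee_vector_Leibniz:
  assumes x: "x \<in> U"
  shows "((\<lambda>y. G y [lee_vector y, w]) has_derivative
    (\<lambda>u. G x [D_lee_vector x u, w] + G x [lee_vector x, D x u w])) (at x)"
    and "((\<lambda>y. F y [lee_vector y, a, b, c]) has_derivative
    (\<lambda>u. F x [D_lee_vector x u, a, b, c] + F x [lee_vector x, D x u a, b, c]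
      + F x [lee_vector x, a, D x u b, c] + F x [lee_vector x, a, b, D x u c])) (at x)"
proof -
  have t: "(lee_vector has_derivative frechet_derivative lee_vector (at x)) (at x)"
    using lee_vector_differentiable[OF x] by (simp add: frechet_derivative_works)
  have G0: "G x [v, 0] = 0" and F0: "F x [v, 0, b, c] = 0" "F x [v, a, 0, c] = 0" "F x [v, a, b, 0] = 0" for v a b c
    using linear_0[OF linear_G(2)[OF x]] linear_0[OF linear_F(2)[OF x]] linear_0[OF linear_F(3)[OF x]]
      linear_0[OF linear_F(4)[OF x]] by blast+
  show "((\<lambda>y. G y [lee_vector y, w]) has_derivative
      (\<lambda>u. G x [D_lee_vector x u, w] + G x [lee_vector x, D x u w])) (at x)"
    using G_Leibniz[OF x t has_derivative_const, of w]
    by (simp add: G0 G_parallel[OF x] D_lee_vector_def linear_add[OF linear_G(1)[OF x]] algebra_simps)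
  show "((\<lambda>y. F y [lee_vector y, a, b, c]) has_derivative
      (\<lambda>u. F x [D_lee_vector x u, a, b, c] + F x [lee_vector x, D x u a, b, c]
        + F x [lee_vector x, a, D x u b, c] + F x [lee_vector x, a, b, D x u c])) (at x)"
    using F_Leibniz[OF x t has_derivative_const has_derivative_const has_derivative_const, of a b c]
    by (simp add: F0 F_parallel[OF x] D_lee_vector_def linear_add[OF linear_F(1)[OF x]] algebra_simps)
qed

lemma cov_deriv_lee:
  assumes x: "x \<in> U"
  shows "cov_deriv_form D \<theta> x u [w] = G x [D_lee_vector x u, w]"
proof -
  have "((\<lambda>y. \<theta> y [w]) has_derivative
      (\<lambda>u. G x [D_lee_vector x u, w] + G x [lee_vector x, D x u w])) (at x)"
    by (rule has_derivative_transform_within_open[OF lee_vector_Leibniz(1)[OF x] open_U x]) (rule G_lee_vector)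
  then have "frechet_derivative (\<lambda>y. \<theta> y [w]) (at x) =
      (\<lambda>u. G x [D_lee_vector x u, w] + G x [lee_vector x, D x u w])"
    by (rule frechet_derivative_at[symmetric])
  then show ?thesis by (simp add: cov_deriv_form_def G_lee_vector[OF x])
qed

text \<open>\<open>C_formula\<close> holds on an open set, so both of its sides have the same
  derivative. Parallelism of the metric and of the 4-form turns these derivatives into covariant
  ones.\<close>

lemma D_C_formula:
  assumes x: "x \<in> U"
  shows "G x [D_C x u v w, z] =
    (G x [D_lee_vector x u, w] * G x [v, z] - G x [D_lee_vector x u, z] * G x [v, w]
      + F x [D_lee_vector x u, v, w, z]) / 16"
proof -
  have G0: "G x [v, 0] = 0" for v
    by (rule linear_0[OF linear_G(2)[OF x]])
  have dGv: "((\<lambda>y. G y [v, w]) has_derivative (\<lambda>u. G x [D x u v, w] + G x [v, D x u w])) (at x)" for v w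
    using has_dG[OF x, of v w] by (simp add: G_parallel[OF x, symmetric])
  note dt = lee_vector_Leibniz[OF x]
  have lhs: "((\<lambda>y. 16 * G y [C y v w, z]) has_derivative
      (\<lambda>u. 16 * (dG x (C x v w) z u + G x [dC x v w u, z] + G x [C x v w, 0]))) (at x)"
    by (rule has_derivative_mult_right[OF G_Leibniz[OF x has_dC[OF x] has_derivative_const]])
  have rhs: "((\<lambda>y. 16 * G y [C y v w, z]) has_derivative
      (\<lambda>u. G x [lee_vector x, w] * (G x [D x u v, z] + G x [v, D x u z])
          + (G x [D_lee_vector x u, w] + G x [lee_vector x, D x u w]) * G x [v, z]
        - (G x [lee_vector x, z] * (G x [D x u v, w] + G x [v, D x u w])
          + (G x [D_lee_vector x u, z] + G x [lee_vector x, D x u z]) * G x [v, w])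
        + (F x [D_lee_vector x u, v, w, z] + F x [lee_vector x, D x u v, w, z]
          + F x [lee_vector x, v, D x u w, z] + F x [lee_vector x, v, w, D x u z]))) (at x)"
    by (rule has_derivative_transform_within_open[OF has_derivative_add[OF has_derivative_diff[OF
          has_derivative_mult[OF dt(1) dGv] has_derivative_mult[OF dt(1) dGv]] dt(2)] open_U x])
       (simp add: C_formula)
  have "16 * (dG x (C x v w) z u + G x [dC x v w u, z] + G x [C x v w, 0]) =
      G x [lee_vector x, w] * (G x [D x u v, z] + G x [v, D x u z])
          + (G x [D_lee_vector x u, w] + G x [lee_vector x, D x u w]) * G x [v, z]
        - (G x [lee_vector x, z] * (G x [D x u v, w] + G x [v, D x u w])
          + (G x [D_lee_vector x u, z] + G x [lee_vector x, D x u z]) * G x [v, w])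
        + (F x [D_lee_vector x u, v, w, z] + F x [lee_vector x, D x u v, w, z]
          + F x [lee_vector x, v, D x u w, z] + F x [lee_vector x, v, w, D x u z])"
    by (rule fun_cong[OF has_derivative_unique[OF lhs rhs]])
  moreover have "G x [D_C x u v w, z] = G x [dC x v w u, z] + G x [D x u (C x v w), z]
      - G x [C x (D x u v) w, z] - G x [C x v (D x u w), z]"
    by (simp add: D_C_def linear_add[OF linear_G(1)[OF x]] linear_diff[OF linear_G(1)[OF x]])
  moreover have "dG x (C x v w) z u = G x [D x u (C x v w), z] + G x [C x v w, D x u z]"
    by (rule G_parallel[OF x])
  \<comment> \<open>The terms in which \<open>D x u\<close> hits one of the arguments
    \<open>v\<close>, \<open>w\<close>, \<open>z\<close> cancel by \<open>C_formula\<close> with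
    that argument replaced.\<close>
  ultimately show ?thesis
    using C_formula[OF x, of "D x u v" w z] C_formula[OF x, of v "D x u w" z] C_formula[OF x, of v w "D x u z"]
    unfolding G0 by (simp add: algebra_simps add_divide_distrib diff_divide_distrib)
qed

lemma D_C_eq_0_iff:
  assumes x: "x \<in> U"
  shows "(\<forall>v w. D_C x u v w = 0) \<longleftrightarrow> D_lee_vector x u = 0"
proof
  interpret adapted "G x" "F x" "basis_at x" by (rule adapted_at[OF x])
  show "D_lee_vector x u = 0" if "\<forall>v w. D_C x u v w = 0"
    using contorsion_trace[OF D_C_formula[OF x], of u] that by simp
  show "\<forall>v w. D_C x u v w = 0" if "D_lee_vector x u = 0"
  proof (intro allI G_nondegenerate)
    show "G x [basis_at x i, D_C x u v w] = G x [basis_at x i, 0]" for v w i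
      using D_C_formula[OF x, of u v w "basis_at x i"] that
      by (simp add: G_sym[of "basis_at x i"] linear_0[OF linear_G1] linear_0[OF linear_F1])
  qed
qed

lemma parallel_torsion_iff:
  assumes x: "x \<in> U"
  shows "(\<forall>u v w. cov_deriv_12 D (\<lambda>y u v. D y u v - N y u v) x u v w = 0) \<longleftrightarrow>
    (\<forall>u w. cov_deriv_form D \<theta> x u [w] = 0)"
proof -
  interpret adapted "G x" "F x" "basis_at x" by (rule adapted_at[OF x])
  have "D_lee_vector x u = 0" if "\<forall>w. G x [D_lee_vector x u, w] = 0" for u
    by (rule G_nondegenerate) (simp add: that G_sym[of "basis_at x _"] linear_0[OF linear_G1])
  then show ?thesis
    unfolding cov_deriv_torsion[OF x] cov_deriv_lee[OF x] neg_equal_0_iff_equal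
    using D_C_eq_0_iff[OF x] linear_0[OF linear_G1] by metis
qed

end

section \<open>From single charts to the manifold\<close>

lemma linear_hodge_last:
  assumes "multilinear_form 2 G"
  shows "linear (\<lambda>v. hodge G F 7 \<omega> [v])"
proof -
  have "linear (\<lambda>v. G ([u, u][1 := v]))" for u
    using assms unfolding multilinear_form_def by (metis length_Cons list.size(3) numeral_2_eq_2 one_less_numeral_iff semiring_norm(76))
  then have G: "linear (\<lambda>v. G [u, v])" for u by simp
  show ?thesis
    unfolding hodge_def hodge_basis_def
  proof (intro linear_compose_sum ballI)
    fix I :: "8 set" assume "I \<in> {I. card I = 7}"
    \<comment> \<open>The seven basis vectors come first and \<open>v\<close> occupies the eighth
      slot of the volume form. The claim is proved for every \<open>e\<close>, in particular for the
      chosen adapted basis.\<close>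
    then have "linear (\<lambda>v. wedge_covectors (map (dual_basis G e) [0,1,2,3,4,5,6,7]) (map e (sorted_list_of_set I) @ [v]))" for e
      by (intro linear_wedge_covectors_last) (use G in \<open>auto simp: dual_basis_def\<close>)
    then show "linear (\<lambda>v. \<omega> (map (SOME e. adapted_basis G F e) (sorted_list_of_set I)) *
        wedge_covectors (map (dual_basis G (SOME e. adapted_basis G F e)) [0,1,2,3,4,5,6,7])
          (map (SOME e. adapted_basis G F e) (sorted_list_of_set I) @ [v]))"
      by (simp add: linear_iff algebra_simps del: wedge_covectors.simps)
  qed
qed

theorem proposition3p1:
  fixes M :: "'a topology" and A :: "('a, 8) chart set"
    and g \<Phi> :: "('a, 8) cov_field"
    and nab D :: "('a, 8) christoffel"
  assumes "smooth_manifold M A"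
    and "riemannian_metric A g"
    and "spin7_structure A g \<Phi>"
    and "locally_conformal_parallel A g \<Phi>"
    and "levi_civita A g nab"
    and "minimal_spin7_connection A g \<Phi> nab D"
  shows "parallel_12 A D (intrinsic_torsion nab D) \<longleftrightarrow> parallel_form A D 1 (lee_form g \<Phi>)"
proof -
  \<comment> \<open>Besides the equation for \<open>d\<Phi>\<close>, linearity is what the chart
    argument uses of the Lee form; it is read off from the outermost star in its definition.\<close>
  have linear_lee: "linear (\<lambda>v. lee_form g \<Phi> c x [v])" if "c \<in> A" "x \<in> chart_image c" for c x
  proof -
    have "multilinear_form 2 (g c x)"
      using assms(2) that by (simp add: riemannian_metric_def tensor_field_def)
    from linear_compose_scale_right[OF linear_hodge_last[OF this], of "1/7"]
    show ?thesis by (simp add: lee_form_def hodge_field_def)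
  qed
  have chart: "spin7_chart (chart_image c) (g c) (\<Phi> c) (lee_form g \<Phi> c) (nab c) (D c)" if c: "c \<in> A" for c
  proof (rule spin7_chart.intro)
    show "open (chart_image c)" using assms(1) c by (simp add: smooth_manifold_def)
    have g: "tensor_field A 2 g" and \<Phi>: "tensor_field A 4 \<Phi>"
      using assms(2,3) by (simp_all add: riemannian_metric_def spin7_structure_def form_field_def)
    have nab: "connection A nab" and D: "connection A D"
      using assms(5,6) by (simp_all add: levi_civita_def minimal_spin7_connection_def)
    fix x assume x: "x \<in> chart_image c"
    show "multilinear_form 2 (g c x)" using g c x by (simp add: tensor_field_def)
    show "g c x [u, v] = g c x [v, u]" for u v
      using assms(2) c x unfolding riemannian_metric_def by blast
    show "alternating_form 4 (\<Phi> c x)"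
      using assms(3) c x by (simp add: spin7_structure_def form_field_def)
    have "smooth_on (chart_image c) (\<lambda>y. g c y [a, b])" for a b
      using g c by (simp add: tensor_field_def)
    then show "(\<lambda>y. g c y [a, b]) differentiable (at x)" for a b
      using x by (rule smooth_on_differentiable)
    have "smooth_on (chart_image c) (\<lambda>y. \<Phi> c y [k, l, m, n])" for k l m n
      using \<Phi> c by (simp add: tensor_field_def)
    then show "(\<lambda>y. \<Phi> c y [k, l, m, n]) differentiable (at x)" for k l m n
      using x by (rule smooth_on_differentiable)
    have "smooth_on (chart_image c) (\<lambda>y. nab c y u v)" for u v
      using nab c by (simp add: connection_def)
    then show "(\<lambda>y. nab c y u v) differentiable (at x)" for u v
      using x by (rule smooth_on_differentiable)
    have "smooth_on (chart_image c) (\<lambda>y. D c y u v)" for u v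
      using D c by (simp add: connection_def)
    then show "(\<lambda>y. D c y u v) differentiable (at x)" for u v
      using x by (rule smooth_on_differentiable)
    show "bilinear (nab c x)" "bilinear (D c x)" using nab D c x by (simp_all add: connection_def)
    show "nab c x u v = nab c x v u" for u v
      using assms(5) c x unfolding levi_civita_def by blast
    show "\<exists>W e. x \<in> W \<and> W \<subseteq> chart_image c \<and> adapted_frame_on W (g c) (\<Phi> c) e"
      using assms(3) c x unfolding spin7_structure_def by blast
    show "ext_deriv (\<Phi> c) x vs = wedge 1 (lee_form g \<Phi> c x) (\<Phi> c x) vs" if "length vs = 5" for vs
      using assms(4) c x that by (simp add: locally_conformal_parallel_def ext_deriv_field_def wedge_field_def)
  next
    fix W e x u
    assume "W \<subseteq> chart_image c" "adapted_frame_on W (g c) (\<Phi> c) e" "x \<in> W"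
    then show "\<exists>B C. form_of_endo (g c x) B \<in> Lambda2_21 (g c x) (\<Phi> c x) \<and>
        form_of_endo (g c x) C \<in> Lambda2_7 (g c x) (\<Phi> c x) \<and>
        (\<forall>j. cov_deriv_vector (nab c) (\<lambda>y. e y j) x u = B (e x j) + C (e x j)) \<and>
        (\<forall>j. cov_deriv_vector (D c) (\<lambda>y. e y j) x u = B (e x j))"
      using assms(6) c unfolding minimal_spin7_connection_def by blast
  qed (rule linear_lee[OF c])
  have "parallel_12 A D (intrinsic_torsion nab D) \<longleftrightarrow>
      (\<forall>c\<in>A. \<forall>x\<in>chart_image c. \<forall>u v w. cov_deriv_12 (D c) (\<lambda>y u v. D c y u v - nab c y u v) x u v w = 0)"
    by (simp add: parallel_12_def intrinsic_torsion_def)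
  also have "\<dots> \<longleftrightarrow> (\<forall>c\<in>A. \<forall>x\<in>chart_image c. \<forall>u w. cov_deriv_form (D c) (lee_form g \<Phi> c) x u [w] = 0)"
    by (intro ball_cong refl spin7_chart.parallel_torsion_iff[OF chart])
  also have "\<dots> \<longleftrightarrow> parallel_form A D 1 (lee_form g \<Phi>)"
    by (auto simp: parallel_form_def length_Suc_conv)
  finally show ?thesis .
qed

end
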